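(* Let $n$ and $r$ be positive integers, and let $(p_L)_{L\subseteq\Pi}$ be real numbers with $p_L\ge 0$ and $\sum_{L\subseteq\Pi}p_L=1$. Let $tv(r,\vec{p})$ denote the total variation distance between the probability measure $\left(\sum_{L \subseteq \Pi} \frac{p_L |S_L|}{n!} X_L\right)^r$ on the symmetric group $S_n$ and the uniform distribution on $S_n$. Let $\pi$ be the Plancherel measure of $S_n$. Then $$\frac{1}{2} \sum_{\lambda \in \mathrm{Irr}(S_n)} \left|\dim(\lambda) \left\langle \chi^{\lambda}, \left(\sum_{L \subseteq \Pi} \frac{p_L |S_L|}{n!} \mathrm{Ind}_{S_L}^{S_n}(1)\right)^r\right\rangle - \pi(\lambda)\right| \leq tv(r,\vec{p}).$$
   Context: Let $\Pi=\{\epsilon_1-\epsilon_2,\dots,\epsilon_{n-1}-\epsilon_n\}$ be the simple roots of the root system $\{\epsilon_i-\epsilon_j: 1\le i\ne j\le n\}$; the roots with $i<j$ are positive and those with $i>j$ are negative. A permutation $g\in S_n$ acts by $g(\epsilon_i-\epsilon_j)=\epsilon_{g(i)}-\epsilon_{g(j)}$. The descent set of $g$ is the set of elements of $\Pi$ that $g$ maps to negative roots (so $\epsilon_i-\epsilon_{i+1}$ is a descent iff $g(i)>g(i+1)$). For $L\subseteq\Pi$, $X_L$ denotes the set of permutations whose descent set is disjoint from $L$, and also the sum of these permutations in the group algebra of $S_n$; $S_L$ is the parabolic subgroup of $S_n$ generated by the roots in $L$, i.e. by the transpositions $(i,i+1)$ with $\epsilon_i-\epsilon_{i+1}\in L$.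 It is known that $|X_L|=n!/|S_L|$, so $\sum_{L}\frac{p_L|S_L|}{n!}X_L$ is a probability measure on $S_n$; its $r$-th power is taken in the group algebra ($r$-fold convolution), and the coefficient of $g$ is the probability of $g$. The total variation distance between probability measures $Q_1,Q_2$ on a finite set $X$ is $\frac12\sum_{x\in X}|Q_1(x)-Q_2(x)|$. $\mathrm{Irr}(S_n)$ is the set of (isomorphism classes of) complex irreducible representations of $S_n$, parameterized by partitions $\lambda$ of $n$; $\chi^\lambda$ and $\dim(\lambda)$ are the character and dimension of the representation corresponding to $\lambda$. The Plancherel measure is $\pi(\lambda)=\dim(\lambda)^2/n!$. $\mathrm{Ind}_{S_L}^{S_n}(1)$ is the character of $S_n$ induced from the trivial character of $S_L$; the $r$-th power of a class function is pointwise; and $\langle f_1,f_2\rangle=\frac{1}{n!}\sum_{g\in S_n}\overline{f_1(g)}f_2(g)$. *)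

theory Defs
  imports Complex_Main "HOL-Algebra.Sym_Groups" "HOL-Algebra.Generated_Groups"
    "HOL-Library.Indicator_Function" "Jordan_Normal_Form.VS_Connect"
begin

section \<open>Roots, descents and parabolic subgroups of the symmetric group\<close>

text \<open>The symmetric group on \<open>{1..n}\<close> is \<^const>\<open>sym_group\<close>, so \<open>g \<otimes> h\<close> is \<open>g \<circ> h\<close>. The root
  \<open>\<epsilon>\<^sub>i - \<epsilon>\<^sub>j\<close> is encoded as the pair \<open>(i, j)\<close>; \<open>map_prod g g\<close> is then the action of \<open>g\<close> on roots.\<close>

definition simple_roots :: "nat \<Rightarrow> (nat \<times> nat) set" where
  "simple_roots n = {(i, Suc i) | i. 1 \<le> i \<and> i < n}"

definition negative_roots :: "nat \<Rightarrow> (nat \<times> nat) set" where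
  "negative_roots n = {(i, j). i \<in> {1..n} \<and> j \<in> {1..n} \<and> i > j}"

definition descent_set :: "nat \<Rightarrow> (nat \<Rightarrow> nat) \<Rightarrow> (nat \<times> nat) set" where
  "descent_set n g = {\<alpha> \<in> simple_roots n. map_prod g g \<alpha> \<in> negative_roots n}"

definition X_set :: "nat \<Rightarrow> (nat \<times> nat) set \<Rightarrow> (nat \<Rightarrow> nat) set" where
  "X_set n L = {g \<in> carrier (sym_group n). descent_set n g \<inter> L = {}}"

definition parabolic :: "nat \<Rightarrow> (nat \<times> nat) set \<Rightarrow> (nat \<Rightarrow> nat) set" where
  "parabolic n L = generate (sym_group n) ((\<lambda>(i, j). Transposition.transpose i j) ` L)"

section \<open>Real group algebra and total variation distance\<close>

text \<open>Elements \<open>\<Sum>\<^sub>g f(g) g\<close> of the group algebra are coefficient functions, extended by 0 outside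
  the group.\<close>

definition group_algebra :: "('a, 'b) monoid_scheme \<Rightarrow> ('a \<Rightarrow> real) ring" where
  "group_algebra G = \<lparr>
     carrier = {f. \<forall>x. x \<notin> carrier G \<longrightarrow> f x = 0},
     mult = (\<lambda>f h g. \<Sum>(a, b) \<in> {(a, b) \<in> carrier G \<times> carrier G. a \<otimes>\<^bsub>G\<^esub> b = g}. f a * h b),
     one = indicator {\<one>\<^bsub>G\<^esub>},
     zero = (\<lambda>g. 0),
     add = (\<lambda>f h g. f g + h g)\<rparr>"

definition total_variation :: "'a set \<Rightarrow> ('a \<Rightarrow> real) \<Rightarrow> ('a \<Rightarrow> real) \<Rightarrow> real" where
  "total_variation X Q1 Q2 = 1 / 2 * (\<Sum>x\<in>X. \<bar>Q1 x - Q2 x\<bar>)"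

section \<open>Complex representations and characters of finite groups\<close>

text \<open>A representation of degree \<open>d\<close> is a homomorphism to \<open>GL\<^sub>d(\<complex>)\<close>, the unit group of the ring of
  complex \<open>d \<times> d\<close> matrices.\<close>

definition mat_representation ::
  "('a, 'b) monoid_scheme \<Rightarrow> nat \<Rightarrow> ('a \<Rightarrow> complex mat) \<Rightarrow> bool" where
  "mat_representation G d \<rho> \<longleftrightarrow> \<rho> \<in> hom G (units_of (ring_mat TYPE(complex) d ()))"

definition invariant_subspace ::
  "('a, 'b) monoid_scheme \<Rightarrow> nat \<Rightarrow> ('a \<Rightarrow> complex mat) \<Rightarrow> complex vec set \<Rightarrow> bool" where
  "invariant_subspace G d \<rho> W \<longleftrightarrow>
     VectorSpace.subspace class_ring W (module_vec TYPE(complex) d) \<and>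
     (\<forall>g \<in> carrier G. \<forall>w \<in> W. \<rho> g *\<^sub>v w \<in> W)"

definition irreducible_rep ::
  "('a, 'b) monoid_scheme \<Rightarrow> nat \<Rightarrow> ('a \<Rightarrow> complex mat) \<Rightarrow> bool" where
  "irreducible_rep G d \<rho> \<longleftrightarrow> mat_representation G d \<rho> \<and> d > 0 \<and>
     (\<forall>W. invariant_subspace G d \<rho> W \<longrightarrow> W = {0\<^sub>v d} \<or> W = carrier_vec d)"

text \<open>Isomorphism of irreducible representations. Values of \<open>\<rho>\<close> outside \<open>carrier G\<close> are irrelevant, so
  \<open>Irr G\<close> has exactly one element for each isomorphism class.\<close>

definition irr_iso ::
  "('a, 'b) monoid_scheme \<Rightarrow> ((nat \<times> ('a \<Rightarrow> complex mat)) \<times> (nat \<times> ('a \<Rightarrow> complex mat))) set" where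
  "irr_iso G = {((d, \<rho>), (d', \<rho>')).
     irreducible_rep G d \<rho> \<and> irreducible_rep G d' \<rho>' \<and> d = d' \<and>
     (\<exists>P \<in> Units (ring_mat TYPE(complex) d ()). \<forall>g \<in> carrier G. P * \<rho> g = \<rho>' g * P)}"

definition Irr :: "('a, 'b) monoid_scheme \<Rightarrow> (nat \<times> ('a \<Rightarrow> complex mat)) set set" where
  "Irr G = {(d, \<rho>). irreducible_rep G d \<rho>} // irr_iso G"

text \<open>Dimension and character are isomorphism invariants, so the choice of the representative does
  not matter on \<open>carrier G\<close>.\<close>

definition irr_dim :: "(nat \<times> ('a \<Rightarrow> complex mat)) set \<Rightarrow> nat" where
  "irr_dim V = fst (SOME R. R \<in> V)"

definition irr_char :: "(nat \<times> ('a \<Rightarrow> complex mat)) set \<Rightarrow> 'a \<Rightarrow> complex" where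
  "irr_char V g = (let (d, \<rho>) = (SOME R. R \<in> V) in \<Sum>i<d. \<rho> g $$ (i, i))"

definition plancherel :: "('a, 'b) monoid_scheme \<Rightarrow> (nat \<times> ('a \<Rightarrow> complex mat)) set \<Rightarrow> real" where
  "plancherel G V = (real (irr_dim V))\<^sup>2 / real (Coset.order G)"

definition induced_char ::
  "('a, 'b) monoid_scheme \<Rightarrow> 'a set \<Rightarrow> ('a \<Rightarrow> complex) \<Rightarrow> 'a \<Rightarrow> complex" where
  "induced_char G H \<psi> g = 1 / of_nat (card H) *
     (\<Sum>x\<in>carrier G. let y = inv\<^bsub>G\<^esub> x \<otimes>\<^bsub>G\<^esub> g \<otimes>\<^bsub>G\<^esub> x in if y \<in> H then \<psi> y else 0)"

definition char_inner ::
  "('a, 'b) monoid_scheme \<Rightarrow> ('a \<Rightarrow> complex) \<Rightarrow> ('a \<Rightarrow> complex) \<Rightarrow> complex" where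
  "char_inner G f1 f2 = 1 / of_nat (Coset.order G) * (\<Sum>g\<in>carrier G. cnj (f1 g) * f2 g)"

end

theory Submission
  imports Defs "Jordan_Normal_Form.Schur_Decomposition" "Jordan_Normal_Form.Spectral_Radius"
begin

text \<open>Let \<open>Q = \<Sum>\<^sub>L a\<^sub>L X\<^sub>L\<close> be the measure of one step, where \<open>a\<^sub>L = p\<^sub>L |S\<^sub>L| / n!\<close>, and let
  \<open>\<phi> = \<Sum>\<^sub>L a\<^sub>L Ind\<^sub>L\<close>, where \<open>Ind\<^sub>L\<close> is the character induced from the trivial character of \<open>S\<^sub>L\<close>. The
  proof rests on two facts.

  The first is that \<open>Q\<^sup>r\<close> and \<open>\<phi>\<^sup>r\<close> are governed by the same coefficients: there are numbers \<open>c\<^sub>N\<close> with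
  \<open>Q\<^sup>r = \<Sum>\<^sub>N c\<^sub>N X\<^sub>N\<close> and \<open>\<phi>\<^sup>r = \<Sum>\<^sub>N c\<^sub>N Ind\<^sub>N\<close>. This is Solomon's theorem on the descent algebra, and it
  is obtained from the product of faces of the braid arrangement. Put the weight \<open>a\<^sub>L\<close> on every face of
  type \<open>L\<close>. The total weight of the faces whose product with the base chamber is the chamber of \<open>w\<close> is then
  \<open>Q(w)\<close> (\<open>chamber_weight_type_weight\<close>), and the total weight of the faces fixed by \<open>g\<close> is \<open>\<phi>(g)\<close>
  (\<open>fixed_weight_type_weight\<close>, \<open>induced_char_parabolic\<close>). Convolving weights on faces multiplies the measures in the
  group algebra by equivariance (\<open>chamber_weight_conv\<close>), and it multiplies the class functions pointwise
  because a product of faces is fixed exactly when both factors are (\<open>fixed_weight_conv\<close>).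

  The second is that \<open>Ind\<^sub>N\<close> is the sum, over all descent sets \<open>D\<close> disjoint from \<open>N\<close>, of the characters \<open>\<beta>\<^sub>D\<close> of
  genuine representations, of degree the number of permutations with descent set \<open>D\<close>. To see this, attach
  to each permutation \<open>w\<close> the indicator function of the left coset of the parabolic subgroup generated by
  the ascents of \<open>w\<close>. These functions form a basis in which, for every \<open>N\<close> simultaneously, the right
  \<open>S\<^sub>N\<close>-invariant functions are spanned by the basis vectors of the permutations in \<open>X\<^sub>N\<close> (\<open>cells_span\<close>,
  \<open>cells_independent\<close>). So left translations act by block triangular matrices (\<open>cell_rep_triangular\<close>), whose
  diagonal blocks are the wanted representations, and the trace on the \<open>S\<^sub>N\<close>-invariant functions is
  \<open>Ind\<^sub>N\<close> (\<open>cell_rep_trace\<close>).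

  Now subtract from \<open>Q\<^sup>r\<close> the uniform distribution \<open>X\<^sub>\<emptyset> / n!\<close>, and correspondingly from \<open>\<phi>\<^sup>r\<close> the function
  \<open>Ind\<^sub>\<emptyset> / n!\<close>, which accounts for the Plancherel measure. The difference of the measures takes a constant value \<open>q\<^sub>D\<close>
  on the permutations with descent set \<open>D\<close>, and the difference of the class functions is
  \<open>\<Sum>\<^sub>D q\<^sub>D \<beta>\<^sub>D\<close>. As multiplicities are non-negative, \<open>\<Sum>\<^sub>\<lambda> dim(\<lambda>) |\<langle>\<chi>\<^sub>\<lambda>, \<Sum>\<^sub>D q\<^sub>D \<beta>\<^sub>D\<rangle>|\<close> is at most
  \<open>\<Sum>\<^sub>D |q\<^sub>D| \<beta>\<^sub>D(1)\<close> (\<open>sum_multiplicities_le_degree\<close>, \<open>multiplicities_le_chamber_weight\<close>), and this is twice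
  the total variation distance.\<close>

section \<open>Idempotent matrices and Schur's lemma\<close>

definition mat_trace :: "complex mat \<Rightarrow> complex" where
  "mat_trace A = (\<Sum>i<dim_row A. A $$ (i, i))"

lemma mult_mat_entry:
  assumes "A \<in> carrier_mat m k" "B \<in> carrier_mat k l" "i < m" "j < l"
  shows "(A * B) $$ (i, j) = (\<Sum>a<k. A $$ (i, a) * B $$ (a, j))"
  using assms by (auto simp: scalar_prod_def lessThan_atLeast0 intro!: sum.cong)

lemma mat_trace_comm:
  assumes A: "A \<in> carrier_mat m k" and B: "B \<in> carrier_mat k m"
  shows "mat_trace (A * B) = mat_trace (B * A)"
proof -
  have "mat_trace (A * B) = (\<Sum>i<m. \<Sum>a<k. A $$ (i, a) * B $$ (a, i))"
    unfolding mat_trace_def using A B by (auto simp: mult_mat_entry[OF A B] simp del: index_mult_mat(1) intro!: sum.cong)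
  also have "\<dots> = (\<Sum>a<k. \<Sum>i<m. B $$ (a, i) * A $$ (i, a))"
    by (subst sum.swap) (simp add: mult.commute)
  also have "\<dots> = mat_trace (B * A)"
    unfolding mat_trace_def using A B by (auto simp: mult_mat_entry[OF B A] simp del: index_mult_mat(1) intro!: sum.cong)
  finally show ?thesis .
qed

text \<open>In triangular form an idempotent has diagonal entries \<open>x\<close> with \<open>x\<^sup>2 = x\<close>, so the trace counts the
  ones on the diagonal. This is how multiplicities turn out to be non-negative and bounded.\<close>

lemma mat_trace_idempotent:
  assumes P: "P \<in> carrier_mat m m" and idem: "P * P = P"
  shows "\<exists>k\<le>m. mat_trace P = of_nat k"
proof -
  obtain as where "char_poly P = (\<Prod>a\<leftarrow>as. [:- a, 1:])"
    using char_poly_factorized[OF P] by auto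
  from schur_decomposition_exists[OF P this] obtain B where
    B: "B \<in> carrier_mat m m" and up: "upper_triangular B" and sim: "similar_mat P B" by auto
  from sim obtain Q S where wit: "similar_mat_wit P B Q S" unfolding similar_mat_def by auto
  note w = similar_mat_witD2[OF P wit]
  have QBS: "P = Q * B * S" and QS: "Q * S = 1\<^sub>m m" and SQ: "S * Q = 1\<^sub>m m"
    and Q: "Q \<in> carrier_mat m m" and S: "S \<in> carrier_mat m m" using w by auto
  have BSP: "B = S * P * Q"
  proof -
    have "S * P * Q = (S * Q) * B * (S * Q)"
      unfolding QBS using Q S B by (simp add: assoc_mult_mat[of _ m m _ m _ m])
    then show ?thesis using B SQ by simp
  qed
  have BB: "B * B = B"
  proof -
    have "B * B = S * P * (Q * S) * P * Q"
      unfolding BSP using Q S P by (simp add: assoc_mult_mat[of _ m m _ m _ m])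
    also have "\<dots> = S * (P * P) * Q"
      using Q S P QS by (simp add: assoc_mult_mat[of _ m m _ m _ m])
    finally show ?thesis using idem BSP by simp
  qed
  have diag: "B $$ (i, i) = (if B $$ (i, i) = 1 then 1 else 0)" if i: "i < m" for i
  proof -
    have "B $$ (i, i) = (\<Sum>a<m. B $$ (i, a) * B $$ (a, i))"
      using mult_mat_entry[OF B B i i] BB by simp
    also have "\<dots> = (\<Sum>a\<in>{i}. B $$ (i, a) * B $$ (a, i))"
    proof (rule sum.mono_neutral_right)
      show "\<forall>a\<in>{..<m} - {i}. B $$ (i, a) * B $$ (a, i) = 0"
      proof
        fix a assume "a \<in> {..<m} - {i}"
        then have "a < i \<or> i < a" "a < m" by auto
        then have "B $$ (i, a) = 0 \<or> B $$ (a, i) = 0"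
          using upper_triangularD[OF up] B i by auto
        then show "B $$ (i, a) * B $$ (a, i) = 0" by auto
      qed
    qed (use i in auto)
    finally show ?thesis by auto
  qed
  have "mat_trace P = mat_trace (S * (Q * B))"
    unfolding QBS using mat_trace_comm[of "Q * B" m m S] Q S B by auto
  also have "S * (Q * B) = B" using Q S B SQ by (simp flip: assoc_mult_mat[of _ m m _ m _ m])
  also have "mat_trace B = (\<Sum>i<m. if B $$ (i, i) = 1 then 1 else 0)"
    unfolding mat_trace_def using B diag by (intro sum.cong) auto
  also have "\<dots> = of_nat (card {i\<in>{..<m}. B $$ (i, i) = 1})"
    by (simp add: sum.If_cases Int_def)
  finally have "mat_trace P = of_nat (card {i\<in>{..<m}. B $$ (i, i) = 1})" .
  moreover have "card {i\<in>{..<m}. B $$ (i, i) = 1} \<le> m"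
    by (rule order_trans[OF card_mono[of "{..<m}"]]) auto
  ultimately show ?thesis by blast
qed

lemma subspace_module_vecI:
  assumes "W \<subseteq> carrier_vec d" "0\<^sub>v d \<in> W"
    "\<And>v w. v \<in> W \<Longrightarrow> w \<in> W \<Longrightarrow> v + w \<in> W"
    "\<And>c v. v \<in> W \<Longrightarrow> c \<cdot>\<^sub>v v \<in> W"
  shows "VectorSpace.subspace class_ring W (module_vec TYPE(complex) d)"
proof -
  interpret vec_space "TYPE(complex)" d .
  show ?thesis
    by unfold_locales (use assms in \<open>auto simp: module_vec_def\<close>)
qed

lemma mat_representationD:
  assumes "mat_representation G d \<rho>"
  shows "g \<in> carrier G \<Longrightarrow> \<rho> g \<in> carrier_mat d d"
    and "g \<in> carrier G \<Longrightarrow> h \<in> carrier G \<Longrightarrow> \<rho> (g \<otimes>\<^bsub>G\<^esub> h) = \<rho> g * \<rho> h"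
  using assms by (auto simp: mat_representation_def hom_def units_of_def Units_def ring_mat_def Pi_def)

lemma (in group) mat_representation_one:
  assumes "mat_representation G d \<rho>"
  shows "\<rho> \<one> = 1\<^sub>m d"
proof -
  interpret R: ring "ring_mat TYPE(complex) d ()" by (rule ring_mat)
  have "\<rho> \<in> hom G (units_of (ring_mat TYPE(complex) d ()))"
    using assms by (simp add: mat_representation_def)
  from hom_one[OF this is_group R.units_group]
  show ?thesis by (simp only: units_of_one ring_mat_simps)
qed

text \<open>The kernel and the image of an intertwiner are invariant, so by irreducibility a nonzero \<open>T\<close> is
  bijective. Equality of the degrees then follows by comparing the traces of \<open>T * S\<close> and
  \<open>S * T\<close>.\<close>

lemma schur_lemma:
  assumes irr: "irreducible_rep G d \<rho>" "irreducible_rep G e \<sigma>"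
    and T: "T \<in> carrier_mat e d" and inter: "\<And>g. g \<in> carrier G \<Longrightarrow> T * \<rho> g = \<sigma> g * T"
    and nz: "T \<noteq> 0\<^sub>m e d"
  shows "d = e \<and> (\<exists>S\<in>carrier_mat d e. T * S = 1\<^sub>m e \<and> S * T = 1\<^sub>m d)"
proof -
  have rep: "mat_representation G d \<rho>" "mat_representation G e \<sigma>"
    using irr by (simp_all add: irreducible_rep_def)
  note \<rho> = mat_representationD(1)[OF rep(1)] and \<sigma> = mat_representationD(1)[OF rep(2)]
  obtain i j where ij: "i < e" "j < d" "T $$ (i, j) \<noteq> 0" 
  proof -
    have "\<exists>i j. i < e \<and> j < d \<and> T $$ (i, j) \<noteq> 0"
    proof (rule ccontr)
      assume "\<not> ?thesis"
      then have "T = 0\<^sub>m e d" using T by (intro eq_matI) auto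
      with nz show False ..
    qed
    then show ?thesis using that by blast
  qed
  have col: "T *\<^sub>v unit_vec d j \<noteq> 0\<^sub>v e"
  proof
    assume "T *\<^sub>v unit_vec d j = 0\<^sub>v e"
    then have "(T *\<^sub>v unit_vec d j) $ i = 0" using ij by simp
    then show False using ij T by simp
  qed
  define K where "K = {v \<in> carrier_vec d. T *\<^sub>v v = 0\<^sub>v e}"
  define I where "I = {T *\<^sub>v v | v. v \<in> carrier_vec d}"
  have comm: "T *\<^sub>v (\<rho> g *\<^sub>v v) = \<sigma> g *\<^sub>v (T *\<^sub>v v)" if "g \<in> carrier G" "v \<in> carrier_vec d" for g v
    using inter[OF that(1)] assoc_mult_mat_vec[OF T \<rho>[OF that(1)] that(2)]
      assoc_mult_mat_vec[OF \<sigma>[OF that(1)] T that(2)] by simp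
  have "invariant_subspace G d \<rho> K"
    unfolding invariant_subspace_def
  proof
    show "VectorSpace.subspace class_ring K (module_vec TYPE(complex) d)"
      by (rule subspace_module_vecI)
        (use T in \<open>auto simp: K_def mult_add_distrib_mat_vec[OF T] mult_mat_vec[OF T]\<close>)
    show "\<forall>g\<in>carrier G. \<forall>w\<in>K. \<rho> g *\<^sub>v w \<in> K"
    proof (intro ballI)
      fix g w assume g: "g \<in> carrier G" and "w \<in> K"
      then have w: "w \<in> carrier_vec d" "T *\<^sub>v w = 0\<^sub>v e" by (auto simp: K_def)
      have "\<sigma> g *\<^sub>v 0\<^sub>v e = 0\<^sub>v e" using \<sigma>[OF g] by (intro eq_vecI) auto
      then show "\<rho> g *\<^sub>v w \<in> K" using comm[OF g w(1)] w \<rho>[OF g] by (auto simp: K_def)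
    qed
  qed
  moreover have "invariant_subspace G e \<sigma> I"
    unfolding invariant_subspace_def
  proof
    show "VectorSpace.subspace class_ring I (module_vec TYPE(complex) e)"
    proof (rule subspace_module_vecI)
      show "I \<subseteq> carrier_vec e" using T by (auto simp: I_def)
      show "0\<^sub>v e \<in> I" unfolding I_def using T by (auto intro!: exI[of _ "0\<^sub>v d"])
      show "v + w \<in> I" if "v \<in> I" "w \<in> I" for v w
      proof -
        from that obtain x y where "x \<in> carrier_vec d" "y \<in> carrier_vec d" "v = T *\<^sub>v x" "w = T *\<^sub>v y"
          unfolding I_def by auto
        then have "x + y \<in> carrier_vec d" "v + w = T *\<^sub>v (x + y)"
          using mult_add_distrib_mat_vec[OF T] by auto
        then show ?thesis unfolding I_def by blast
      qed
      show "c \<cdot>\<^sub>v v \<in> I" if "v \<in> I" for c v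
      proof -
        from that obtain x where "x \<in> carrier_vec d" "v = T *\<^sub>v x"
          unfolding I_def by auto
        then have "c \<cdot>\<^sub>v x \<in> carrier_vec d" "c \<cdot>\<^sub>v v = T *\<^sub>v (c \<cdot>\<^sub>v x)"
          using mult_mat_vec[OF T] by auto
        then show ?thesis unfolding I_def by blast
      qed
    qed
    show "\<forall>g\<in>carrier G. \<forall>w\<in>I. \<sigma> g *\<^sub>v w \<in> I"
    proof (intro ballI)
      fix g w assume g: "g \<in> carrier G" and "w \<in> I"
      then obtain v where v: "v \<in> carrier_vec d" "w = T *\<^sub>v v" unfolding I_def by auto
      then show "\<sigma> g *\<^sub>v w \<in> I" using comm[OF g v(1)] \<rho>[OF g] unfolding I_def
        by (auto intro!: exI[of _ "\<rho> g *\<^sub>v v"])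
    qed
  qed
  ultimately have "K = {0\<^sub>v d} \<or> K = carrier_vec d" "I = {0\<^sub>v e} \<or> I = carrier_vec e"
    using irr by (simp_all add: irreducible_rep_def)
  moreover have "unit_vec d j \<notin> K" using col by (simp add: K_def)
  moreover have "T *\<^sub>v unit_vec d j \<in> I" unfolding I_def by auto
  ultimately have K: "K = {0\<^sub>v d}" and I: "I = carrier_vec e"
    using col by auto
  have "\<forall>a<e. \<exists>v\<in>carrier_vec d. T *\<^sub>v v = unit_vec e a"
  proof (intro allI impI)
    fix a
    have "unit_vec e a \<in> I" using I by simp
    then show "\<exists>v\<in>carrier_vec d. T *\<^sub>v v = unit_vec e a" unfolding I_def by force
  qed
  then obtain s where s: "\<And>a. a < e \<Longrightarrow> s a \<in> carrier_vec d" "\<And>a. a < e \<Longrightarrow> T *\<^sub>v s a = unit_vec e a"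
    by metis
  define S where "S = mat d e (\<lambda>(i, a). s a $ i)"
  have S: "S \<in> carrier_mat d e" unfolding S_def by simp
  have colS: "col S a = s a" if "a < e" for a
    using s(1)[OF that] that by (intro eq_vecI) (auto simp: S_def)
  have TS: "T * S = 1\<^sub>m e"
  proof (rule mat_col_eqI)
    fix a assume "a < dim_col (1\<^sub>m e :: complex mat)"
    then have "a < e" by simp
    then have "col (T * S) a = unit_vec e a"
      by (simp only: col_mult2[OF T S] colS s(2))
    then show "col (T * S) a = col (1\<^sub>m e) a"
      using \<open>a < e\<close> by simp
  qed (use T S in auto)
  have ST: "S * T = 1\<^sub>m d"
  proof (rule mat_col_eqI)
    fix a assume "a < dim_col (1\<^sub>m d :: complex mat)"
    then have a: "a < d" by simp
    define v where "v = S *\<^sub>v (T *\<^sub>v unit_vec d a) - unit_vec d a"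
    have v: "v \<in> carrier_vec d" unfolding v_def using S T by auto
    have c1: "T *\<^sub>v unit_vec d a \<in> carrier_vec e" using T by auto
    have "T *\<^sub>v v = T *\<^sub>v (S *\<^sub>v (T *\<^sub>v unit_vec d a)) - T *\<^sub>v unit_vec d a"
      unfolding v_def using S T by (intro mult_minus_distrib_mat_vec) auto
    also have "T *\<^sub>v (S *\<^sub>v (T *\<^sub>v unit_vec d a)) = T *\<^sub>v unit_vec d a"
      using assoc_mult_mat_vec[OF T S c1] TS c1 by simp
    finally have "v \<in> K" using v c1 by (simp add: K_def)
    then have v0: "v = 0\<^sub>v d" using K by simp
    have "col (S * T) a = S *\<^sub>v (T *\<^sub>v unit_vec d a)"
    proof -
      have "T *\<^sub>v unit_vec d a = col T a" using T a by (intro eq_vecI) auto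
      then show ?thesis by (simp only: col_mult2[OF S T a])
    qed
    also have "\<dots> = v + unit_vec d a" unfolding v_def using S T
      by (intro eq_vecI) auto
    also have "\<dots> = unit_vec d a" unfolding v0 by simp
    finally show "col (S * T) a = col (1\<^sub>m d) a" using a by simp
  qed (use T S in auto)
  have "of_nat e = (of_nat d :: complex)"
    using mat_trace_comm[OF T S] unfolding TS ST by (simp add: mat_trace_def one_mat_def)
  then have "d = e" by simp
  with S TS ST show ?thesis by (intro conjI bexI[of _ S])
qed


text \<open>An eigenvalue \<open>c\<close> of \<open>T\<close> makes \<open>T - c\<close> a singular intertwiner, hence zero.\<close>

lemma schur_scalar:
  assumes irr: "irreducible_rep G d \<rho>" and T: "T \<in> carrier_mat d d"
    and inter: "\<And>g. g \<in> carrier G \<Longrightarrow> T * \<rho> g = \<rho> g * T"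
  shows "\<exists>c. T = c \<cdot>\<^sub>m 1\<^sub>m d"
proof -
  have d: "d > 0" and rep: "mat_representation G d \<rho>"
    using irr by (simp_all add: irreducible_rep_def)
  note \<rho> = mat_representationD(1)[OF rep]
  obtain c where "eigenvalue T c"
    using spectrum_non_empty[OF T d] unfolding spectrum_def by auto
  then obtain v where v: "v \<in> carrier_vec d" "v \<noteq> 0\<^sub>v d" "T *\<^sub>v v = c \<cdot>\<^sub>v v"
    using T unfolding eigenvalue_def eigenvector_def by auto
  \<comment> \<open>an intertwiner with the eigenvector \<open>v\<close> in its kernel\<close>
  define U where "U = T - c \<cdot>\<^sub>m 1\<^sub>m d"
  have U: "U \<in> carrier_mat d d" unfolding U_def using T by auto
  have "U * \<rho> g = \<rho> g * U" if g: "g \<in> carrier G" for g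
  proof -
    have "U * \<rho> g = T * \<rho> g - c \<cdot>\<^sub>m \<rho> g"
      unfolding U_def using T \<rho>[OF g] by (subst minus_mult_distrib_mat[of _ d d]) auto
    also have "\<dots> = \<rho> g * U"
      unfolding U_def inter[OF g] using T \<rho>[OF g]
      by (subst mult_minus_distrib_mat[of _ d d]) auto
    finally show ?thesis .
  qed
  note schur = schur_lemma[OF irr irr U this]
  have Uv: "U *\<^sub>v v = 0\<^sub>v d"
  proof -
    have "U *\<^sub>v v = T *\<^sub>v v - (c \<cdot>\<^sub>m 1\<^sub>m d) *\<^sub>v v"
      unfolding U_def using T v(1) by (intro minus_mult_distrib_mat_vec) auto
    also have "(c \<cdot>\<^sub>m 1\<^sub>m d) *\<^sub>v v = c \<cdot>\<^sub>v v"
      using v(1) by (intro eq_vecI) auto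
    finally show ?thesis using v by auto
  qed
  have "U = 0\<^sub>m d d"
  proof (rule ccontr)
    assume "U \<noteq> 0\<^sub>m d d"
    then obtain S where S: "S \<in> carrier_mat d d" "S * U = 1\<^sub>m d" using schur by blast
    have "v = (S * U) *\<^sub>v v" using S v by simp
    also have "\<dots> = S *\<^sub>v 0\<^sub>v d" using assoc_mult_mat_vec[OF S(1) U v(1)] Uv by simp
    also have "\<dots> = 0\<^sub>v d" using S(1) by (intro eq_vecI) auto
    finally show False using v(2) by simp
  qed
  have "T = c \<cdot>\<^sub>m 1\<^sub>m d"
  proof (rule eq_matI)
    fix i j assume "i < dim_row (c \<cdot>\<^sub>m 1\<^sub>m d)" "j < dim_col (c \<cdot>\<^sub>m 1\<^sub>m d)"
    then have ij: "i < d" "j < d" by auto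
    have "U $$ (i, j) = 0" using \<open>U = 0\<^sub>m d d\<close> ij by simp
    then show "T $$ (i, j) = (c \<cdot>\<^sub>m 1\<^sub>m d) $$ (i, j)" unfolding U_def using ij T by simp
  qed (use T in auto)
  then show ?thesis ..
qed

section \<open>Orthogonality of matrix coefficients\<close>

definition irr_rep :: "(nat \<times> ('a \<Rightarrow> complex mat)) set \<Rightarrow> 'a \<Rightarrow> complex mat" where
  "irr_rep V = snd (SOME R. R \<in> V)"

context group
begin

lemma sum_translate:
  assumes "h \<in> carrier G"
  shows "(\<Sum>g\<in>carrier G. f (h \<otimes> g)) = (\<Sum>g\<in>carrier G. f g)"
  by (rule sum.reindex_bij_witness[of _ "\<lambda>g. inv h \<otimes> g" "\<lambda>g. h \<otimes> g"])
    (use assms in \<open>auto simp flip: m_assoc\<close>)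

lemma sum_inverse:
  "(\<Sum>g\<in>carrier G. f (inv g)) = (\<Sum>g\<in>carrier G. f g)"
  by (rule sum.reindex_bij_witness[of _ "\<lambda>g. inv g" "\<lambda>g. inv g"]) auto

definition matrix_coeff_sum ::
  "('a \<Rightarrow> complex mat) \<Rightarrow> ('a \<Rightarrow> complex mat) \<Rightarrow> nat \<Rightarrow> nat \<Rightarrow> nat \<Rightarrow> nat \<Rightarrow> complex" where
  "matrix_coeff_sum \<sigma> \<rho> i j k l = (\<Sum>g\<in>carrier G. \<sigma> g $$ (i, j) * \<rho> (inv g) $$ (k, l))"

text \<open>For an elementary matrix \<open>E\<^sub>j\<^sub>k\<close>, the average of \<open>\<sigma> g * E\<^sub>j\<^sub>k * \<rho> (inv g)\<close> over the group is
  an intertwiner; its entries are the sums studied here. Schur's lemma evaluates them.\<close>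

lemma matrix_coeff_sum_intertwines:
  assumes \<rho>: "mat_representation G d \<rho>" and \<sigma>: "mat_representation G e \<sigma>"
    and jk: "j < e" "k < d" and h: "h \<in> carrier G"
  defines "T \<equiv> mat e d (\<lambda>(i, l). matrix_coeff_sum \<sigma> \<rho> i j k l)"
  shows "T * \<rho> h = \<sigma> h * T"
proof (rule eq_matI)
  note \<rho>D = mat_representationD[OF \<rho>] and \<sigma>D = mat_representationD[OF \<sigma>]
  have T: "T \<in> carrier_mat e d" unfolding T_def by simp
  show "dim_row (T * \<rho> h) = dim_row (\<sigma> h * T)" "dim_col (T * \<rho> h) = dim_col (\<sigma> h * T)"
    using T \<rho>D(1)[OF h] \<sigma>D(1)[OF h] by auto
  fix i l assume "i < dim_row (\<sigma> h * T)" "l < dim_col (\<sigma> h * T)"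
  then have il: "i < e" "l < d" using T \<sigma>D(1)[OF h] by auto
  have "(T * \<rho> h) $$ (i, l)
      = (\<Sum>a<d. \<Sum>g\<in>carrier G. \<sigma> g $$ (i, j) * (\<rho> (inv g) $$ (k, a) * \<rho> h $$ (a, l)))"
    unfolding mult_mat_entry[OF T \<rho>D(1)[OF h] il]
    by (intro sum.cong refl) (simp add: T_def il matrix_coeff_sum_def sum_distrib_right mult.assoc)
  also have "\<dots> = (\<Sum>g\<in>carrier G. \<sigma> g $$ (i, j) * (\<Sum>a<d. \<rho> (inv g) $$ (k, a) * \<rho> h $$ (a, l)))"
    by (subst sum.swap) (simp add: sum_distrib_left)
  also have "\<dots> = (\<Sum>g\<in>carrier G. \<sigma> g $$ (i, j) * \<rho> (inv g \<otimes> h) $$ (k, l))"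
    by (intro sum.cong refl) (simp add: \<rho>D(2) h mult_mat_entry[OF \<rho>D(1) \<rho>D(1)[OF h] jk(2) il(2)])
  also have "\<dots> = (\<Sum>g\<in>carrier G. \<sigma> (h \<otimes> g) $$ (i, j) * \<rho> (inv (h \<otimes> g) \<otimes> h) $$ (k, l))"
    by (rule sum_translate[OF h, symmetric])
  also have "\<dots> = (\<Sum>g\<in>carrier G. (\<Sum>a<e. \<sigma> h $$ (i, a) * \<sigma> g $$ (a, j)) * \<rho> (inv g) $$ (k, l))"
    by (intro sum.cong refl)
      (simp add: \<sigma>D(2) h inv_mult_group m_assoc mult_mat_entry[OF \<sigma>D(1)[OF h] \<sigma>D(1) il(1) jk(1)])
  also have "\<dots> = (\<Sum>a<e. \<Sum>g\<in>carrier G. \<sigma> h $$ (i, a) * (\<sigma> g $$ (a, j) * \<rho> (inv g) $$ (k, l)))"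
    by (subst sum.swap) (simp add: sum_distrib_right mult.assoc)
  also have "\<dots> = (\<sigma> h * T) $$ (i, l)"
    unfolding mult_mat_entry[OF \<sigma>D(1)[OF h] T il]
    by (intro sum.cong refl) (simp add: T_def il matrix_coeff_sum_def sum_distrib_left)
  finally show "(T * \<rho> h) $$ (i, l) = (\<sigma> h * T) $$ (i, l)" .
qed

lemma matrix_coeffs_orthogonal:
  assumes irr: "irreducible_rep G d \<rho>" "irreducible_rep G e \<sigma>"
    and niso: "((d, \<rho>), (e, \<sigma>)) \<notin> irr_iso G"
    and b: "i < e" "j < e" "k < d" "l < d"
  shows "matrix_coeff_sum \<sigma> \<rho> i j k l = 0"
proof -
  define T where "T = mat e d (\<lambda>(i, l). matrix_coeff_sum \<sigma> \<rho> i j k l)"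
  have T: "T \<in> carrier_mat e d" unfolding T_def by simp
  have rep: "mat_representation G d \<rho>" "mat_representation G e \<sigma>"
    using irr by (auto simp: irreducible_rep_def)
  have inter: "T * \<rho> g = \<sigma> g * T" if "g \<in> carrier G" for g
    unfolding T_def by (rule matrix_coeff_sum_intertwines[OF rep b(2,3) that])
  have "T = 0\<^sub>m e d"
  proof (rule ccontr)
    assume "T \<noteq> 0\<^sub>m e d"
    from schur_lemma[OF irr T inter this] obtain S where
      S: "d = e" "S \<in> carrier_mat d e" "T * S = 1\<^sub>m e" "S * T = 1\<^sub>m d" by auto
    then have "T \<in> Units (ring_mat TYPE(complex) d ())"
      using T by (auto simp: Units_def ring_mat_simps ring_mat_def intro!: bexI[of _ S])
    then have "((d, \<rho>), (e, \<sigma>)) \<in> irr_iso G"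
      using irr S(1) inter unfolding irr_iso_def by auto
    with niso show False ..
  qed
  then have "T $$ (i, l) = 0" using b by simp
  then show ?thesis using b by (simp add: T_def)
qed

text \<open>The intertwiner is a scalar \<open>c\<close>, and its trace \<open>c * d\<close> collapses to a sum of
  \<open>\<rho> (inv g \<otimes> g)\<close> over the group.\<close>

lemma matrix_coeffs_norm:
  assumes irr: "irreducible_rep G d \<rho>" and b: "i < d" "j < d" "k < d" "l < d"
  shows "matrix_coeff_sum \<rho> \<rho> i j k l
      = (if i = l \<and> j = k then of_nat (card (carrier G)) / of_nat d else 0)"
proof -
  define T where "T = mat d d (\<lambda>(i, l). matrix_coeff_sum \<rho> \<rho> i j k l)"
  have T: "T \<in> carrier_mat d d" unfolding T_def by simp
  have rep: "mat_representation G d \<rho>" and d: "d > 0"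
    using irr by (auto simp: irreducible_rep_def)
  note \<rho>D = mat_representationD[OF rep]
  have "T * \<rho> g = \<rho> g * T" if "g \<in> carrier G" for g
    unfolding T_def by (rule matrix_coeff_sum_intertwines[OF rep rep b(2,3) that])
  from schur_scalar[OF irr T this] obtain c where c: "T = c \<cdot>\<^sub>m 1\<^sub>m d" by auto
  have "c * of_nat d = (\<Sum>a<d. T $$ (a, a))"
    unfolding c by simp
  also have "\<dots> = (\<Sum>g\<in>carrier G. \<Sum>a<d. \<rho> (inv g) $$ (k, a) * \<rho> g $$ (a, j))"
    by (subst sum.swap) (simp add: T_def matrix_coeff_sum_def mult.commute)
  also have "\<dots> = (\<Sum>g\<in>carrier G. \<rho> \<one> $$ (k, j))"
    by (intro sum.cong refl)
      (simp add: \<rho>D(2)[symmetric] mult_mat_entry[OF \<rho>D(1) \<rho>D(1) b(3) b(2), symmetric]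
        del: index_mult_mat)
  also have "\<dots> = (if j = k then of_nat (card (carrier G)) else 0)"
    using b by (simp add: mat_representation_one[OF rep])
  finally have "c = (if j = k then of_nat (card (carrier G)) / of_nat d else 0)"
    using d by (auto simp: field_simps)
  moreover have "matrix_coeff_sum \<rho> \<rho> i j k l = T $$ (i, l)" using b by (simp add: T_def)
  ultimately show ?thesis using b by (auto simp: c)
qed

lemma irr_iso_iff:
  "((d, \<rho>), (e, \<sigma>)) \<in> irr_iso G \<longleftrightarrow>
    irreducible_rep G d \<rho> \<and> irreducible_rep G e \<sigma> \<and> d = e \<and>
    (\<exists>P\<in>carrier_mat d d. \<exists>S\<in>carrier_mat d d. S * P = 1\<^sub>m d \<and> P * S = 1\<^sub>m d \<and>
      (\<forall>g\<in>carrier G. P * \<rho> g = \<sigma> g * P))"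
  unfolding irr_iso_def Units_def ring_mat_simps mem_Collect_eq prod.case by blast

lemma irr_iso_equiv: "equiv {(d, \<rho>). irreducible_rep G d \<rho>} (irr_iso G)"
proof (rule equivI)
  show "irr_iso G \<subseteq> {(d, \<rho>). irreducible_rep G d \<rho>} \<times> {(d, \<rho>). irreducible_rep G d \<rho>}"
    unfolding irr_iso_def by blast
  show "refl_on {(d, \<rho>). irreducible_rep G d \<rho>} (irr_iso G)"
  proof (rule refl_onI, clarify)
    fix d \<rho> assume irr: "irreducible_rep G d \<rho>"
    then have "mat_representation G d \<rho>" by (simp add: irreducible_rep_def)
    note \<rho> = mat_representationD(1)[OF this]
    have "\<forall>g\<in>carrier G. 1\<^sub>m d * \<rho> g = \<rho> g * 1\<^sub>m d"
      using left_mult_one_mat[OF \<rho>] right_mult_one_mat[OF \<rho>] by simp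
    then show "((d, \<rho>), (d, \<rho>)) \<in> irr_iso G" using irr unfolding irr_iso_iff
      by (intro conjI bexI[of _ "1\<^sub>m d"]) simp_all
  qed
  show "sym (irr_iso G)"
  proof (rule symI, clarify)
    fix d \<rho> e \<sigma> assume "((d, \<rho>), (e, \<sigma>)) \<in> irr_iso G"
    then have irr: "irreducible_rep G d \<rho>" "irreducible_rep G e \<sigma>" and e: "d = e"
      and ex: "\<exists>P\<in>carrier_mat d d. \<exists>S\<in>carrier_mat d d. S * P = 1\<^sub>m d \<and> P * S = 1\<^sub>m d \<and>
        (\<forall>g\<in>carrier G. P * \<rho> g = \<sigma> g * P)"
      unfolding irr_iso_iff by blast+
    from ex obtain P S where Pc: "P \<in> carrier_mat d d" and S: "S \<in> carrier_mat d d" "S * P = 1\<^sub>m d" "P * S = 1\<^sub>m d"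
      and P: "\<And>g. g \<in> carrier G \<Longrightarrow> P * \<rho> g = \<sigma> g * P" by blast
    have rep: "mat_representation G d \<rho>" "mat_representation G d \<sigma>"
      using irr e by (simp_all add: irreducible_rep_def)
    have "S * \<sigma> g = \<rho> g * S" if g: "g \<in> carrier G" for g
    proof -
      note c = mat_representationD(1)[OF rep(1) g] mat_representationD(1)[OF rep(2) g]
      have "S * \<sigma> g = S * \<sigma> g * (P * S)" using S c by simp
      also have "\<dots> = S * (\<sigma> g * P) * S" using S(1) Pc c by (simp add: assoc_mult_mat[of _ d d _ d _ d])
      also have "\<dots> = (S * P) * \<rho> g * S" unfolding P[OF g, symmetric]
        using S(1) Pc c by (simp add: assoc_mult_mat[of _ d d _ d _ d])
      finally show ?thesis using S(1,2) c by simp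
    qed
    then show "((e, \<sigma>), (d, \<rho>)) \<in> irr_iso G" unfolding irr_iso_iff using irr e S Pc by blast
  qed
  show "trans (irr_iso G)"
  proof (rule transI, clarify)
    fix d \<rho> e \<sigma> f \<tau>
    assume "((d, \<rho>), (e, \<sigma>)) \<in> irr_iso G" "((e, \<sigma>), (f, \<tau>)) \<in> irr_iso G"
    then have irr0: "irreducible_rep G d \<rho>" "irreducible_rep G e \<sigma>" "irreducible_rep G f \<tau>"
      and de: "d = e" and ef0: "e = f"
      and ex1: "\<exists>P\<in>carrier_mat d d. \<exists>S\<in>carrier_mat d d. S * P = 1\<^sub>m d \<and> P * S = 1\<^sub>m d \<and>
        (\<forall>g\<in>carrier G. P * \<rho> g = \<sigma> g * P)"
      and ex2e: "\<exists>P\<in>carrier_mat e e. \<exists>S\<in>carrier_mat e e. S * P = 1\<^sub>m e \<and> P * S = 1\<^sub>m e \<and>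
        (\<forall>g\<in>carrier G. P * \<sigma> g = \<tau> g * P)"
      unfolding irr_iso_iff by blast+
    have ef: "e = d" "f = d" using de ef0 by simp_all
    note irr = irr0[unfolded ef] and ex2 = ex2e[unfolded ef]
    from ex1 obtain P S where P: "P \<in> carrier_mat d d" "S \<in> carrier_mat d d" "S * P = 1\<^sub>m d" "P * S = 1\<^sub>m d"
      and P\<rho>: "\<And>g. g \<in> carrier G \<Longrightarrow> P * \<rho> g = \<sigma> g * P" by blast
    from ex2 obtain Q U where Q: "Q \<in> carrier_mat d d" "U \<in> carrier_mat d d" "U * Q = 1\<^sub>m d" "Q * U = 1\<^sub>m d"
      and Q\<sigma>: "\<And>g. g \<in> carrier G \<Longrightarrow> Q * \<sigma> g = \<tau> g * Q" by blast
    have rep: "mat_representation G d \<rho>" "mat_representation G d \<sigma>" "mat_representation G d \<tau>"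
      using irr by (simp_all add: irreducible_rep_def)
    have "S * U * (Q * P) = S * (U * Q) * P"
      using P(1,2) Q(1,2) by (simp add: assoc_mult_mat[of _ d d _ d _ d])
    then have "S * U * (Q * P) = 1\<^sub>m d" using P(2,3) Q(3) by simp
    moreover have "Q * P * (S * U) = Q * (P * S) * U"
      using P(1,2) Q(1,2) by (simp add: assoc_mult_mat[of _ d d _ d _ d])
    then have "Q * P * (S * U) = 1\<^sub>m d" using Q(1,4) P(4) by simp
    moreover have "Q * P * \<rho> g = \<tau> g * (Q * P)" if g: "g \<in> carrier G" for g
    proof -
      note c = mat_representationD(1)[OF rep(1) g] mat_representationD(1)[OF rep(2) g]
        mat_representationD(1)[OF rep(3) g]
      have "Q * P * \<rho> g = Q * (\<sigma> g * P)"
        using P(1) Q(1) c P\<rho>[OF g] by (simp add: assoc_mult_mat[of _ d d _ d _ d])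
      also have "\<dots> = Q * \<sigma> g * P" using P(1) Q(1) c by (simp add: assoc_mult_mat[of _ d d _ d _ d])
      finally show ?thesis using P(1) Q(1) c unfolding Q\<sigma>[OF g]
        by (simp add: assoc_mult_mat[of _ d d _ d _ d])
    qed
    moreover have "Q * P \<in> carrier_mat d d" "S * U \<in> carrier_mat d d" using P(1,2) Q(1,2) by auto
    ultimately show "((d, \<rho>), (f, \<tau>)) \<in> irr_iso G" unfolding irr_iso_iff using irr ef by blast
  qed
qed

lemma Irr_representative:
  assumes "V \<in> Irr G"
  shows "(irr_dim V, irr_rep V) \<in> V" "irreducible_rep G (irr_dim V) (irr_rep V)"
proof -
  have "V \<noteq> {}" using in_quotient_imp_non_empty[OF irr_iso_equiv] assms unfolding Irr_def by blast
  then have "(SOME R. R \<in> V) \<in> V" by (simp add: some_in_eq)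
  then show "(irr_dim V, irr_rep V) \<in> V" by (simp add: irr_dim_def irr_rep_def)
  with in_quotient_imp_subset[OF irr_iso_equiv] assms
  show "irreducible_rep G (irr_dim V) (irr_rep V)" unfolding Irr_def by blast
qed

lemma Irr_not_iso:
  assumes "V \<in> Irr G" "W \<in> Irr G" "V \<noteq> W"
  shows "((irr_dim V, irr_rep V), (irr_dim W, irr_rep W)) \<notin> irr_iso G"
  using quotient_eq_iff[OF irr_iso_equiv, of V W] Irr_representative(1)[OF assms(1)]
    Irr_representative(1)[OF assms(2)] assms unfolding Irr_def by blast

lemma irr_char_eq: "irr_char V g = (\<Sum>i<irr_dim V. irr_rep V g $$ (i, i))"
  by (simp add: irr_char_def irr_dim_def irr_rep_def Let_def split_beta)

lemma irr_char_one:
  assumes "V \<in> Irr G" shows "irr_char V \<one> = of_nat (irr_dim V)"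
proof -
  have "mat_representation G (irr_dim V) (irr_rep V)"
    using Irr_representative(2)[OF assms] by (simp add: irreducible_rep_def)
  then show ?thesis by (simp add: irr_char_eq mat_representation_one)
qed

text \<open>The characters are orthogonal idempotents for convolution, up to the factors
  \<open>card (carrier G) / irr_dim V\<close>.\<close>

lemma irr_char_convolution:
  assumes V: "V \<in> Irr G" and W: "W \<in> Irr G" and k: "k \<in> carrier G"
  shows "(\<Sum>g\<in>carrier G. irr_char V (inv g) * irr_char W (inv k \<otimes> g))
    = (if V = W then of_nat (card (carrier G)) / of_nat (irr_dim V) * irr_char V (inv k) else 0)"
proof -
  define d where "d = irr_dim V"
  define e where "e = irr_dim W"
  define \<rho> where "\<rho> = irr_rep V"
  define \<sigma> where "\<sigma> = irr_rep W"
  have irr: "irreducible_rep G d \<rho>" "irreducible_rep G e \<sigma>"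
    unfolding d_def e_def \<rho>_def \<sigma>_def by (rule Irr_representative(2)[OF V] Irr_representative(2)[OF W])+
  then have rep: "mat_representation G d \<rho>" "mat_representation G e \<sigma>"
    by (simp_all add: irreducible_rep_def)
  note \<sigma>D = mat_representationD[OF rep(2)]
  let ?c = "of_nat (card (carrier G)) / of_nat d :: complex"
  have entry: "matrix_coeff_sum \<sigma> \<rho> j i a a = (if V = W \<and> j = a \<and> i = a then ?c else 0)"
    if "i < e" "j < e" "a < d" for i j a
  proof (cases "V = W")
    case True
    then have "e = d" "\<sigma> = \<rho>" by (simp_all add: d_def e_def \<rho>_def \<sigma>_def)
    then show ?thesis using matrix_coeffs_norm[OF irr(1), of j i a a] that True by auto
  next
    case False
    then show ?thesis
      using matrix_coeffs_orthogonal[OF irr _ that(2,1,3,3)] Irr_not_iso[OF V W]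
      by (simp add: d_def e_def \<rho>_def \<sigma>_def)
  qed
  have "(\<Sum>g\<in>carrier G. irr_char V (inv g) * irr_char W (inv k \<otimes> g))
      = (\<Sum>g\<in>carrier G. \<Sum>a<d. \<Sum>i<e. \<Sum>j<e. \<sigma> (inv k) $$ (i, j) * (\<sigma> g $$ (j, i) * \<rho> (inv g) $$ (a, a)))"
  proof (rule sum.cong[OF refl])
    fix g assume g: "g \<in> carrier G"
    have "irr_char W (inv k \<otimes> g) = (\<Sum>i<e. \<Sum>j<e. \<sigma> (inv k) $$ (i, j) * \<sigma> g $$ (j, i))"
      unfolding irr_char_eq e_def[symmetric] \<sigma>_def[symmetric]
      using k g by (simp add: \<sigma>D(2) mult_mat_entry[OF \<sigma>D(1) \<sigma>D(1)] del: index_mult_mat)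
    then show "irr_char V (inv g) * irr_char W (inv k \<otimes> g)
      = (\<Sum>a<d. \<Sum>i<e. \<Sum>j<e. \<sigma> (inv k) $$ (i, j) * (\<sigma> g $$ (j, i) * \<rho> (inv g) $$ (a, a)))"
      unfolding irr_char_eq[of V] d_def[symmetric] \<rho>_def[symmetric]
      by (simp only: sum_product) (simp add: sum_distrib_left mult_ac)
  qed
  also have "\<dots> = (\<Sum>a<d. \<Sum>i<e. \<Sum>j<e. \<sigma> (inv k) $$ (i, j) * matrix_coeff_sum \<sigma> \<rho> j i a a)"
    unfolding matrix_coeff_sum_def sum_distrib_left
    by (subst sum.swap, rule sum.cong[OF refl], subst sum.swap, rule sum.cong[OF refl],
        subst sum.swap, rule refl)
  also have "\<dots> = (\<Sum>a<d. \<Sum>i<e. \<Sum>j<e.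
      if j = a then (if i = a then (if V = W then \<sigma> (inv k) $$ (i, j) * ?c else 0) else 0) else 0)"
    by (intro sum.cong refl) (simp add: entry)
  also have "\<dots> = (if V = W then ?c * irr_char V (inv k) else 0)"
  proof (cases "V = W")
    case True
    then have "e = d" "\<sigma> = \<rho>" by (simp_all add: d_def e_def \<rho>_def \<sigma>_def)
    moreover have "irr_char V (inv k) = (\<Sum>a<d. \<rho> (inv k) $$ (a, a))"
      by (simp add: irr_char_eq d_def \<rho>_def)
    ultimately show ?thesis using True by (simp add: sum_distrib_left mult.commute)
  qed simp
  finally show ?thesis unfolding d_def .
qed

text \<open>The term for \<open>V\<close> is the multiplicity of \<open>V\<close> in \<open>R\<close> times the dimension of \<open>V\<close>. By the
  convolution identity the matrices \<open>E V\<close>, the projections onto the isotypic components, are orthogonal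
  idempotents. So each has a non-negative integer trace, and their sum is an idempotent, whose trace is
  at most \<open>m\<close>. An infinite sum over \<open>Irr G\<close> would have the default value \<open>0\<close>, for which the bound is clear.\<close>

theorem sum_multiplicities_le_degree:
  fixes R :: "'a \<Rightarrow> complex mat"
  assumes R: "\<And>g. g \<in> carrier G \<Longrightarrow> R g \<in> carrier_mat m m"
    and mult: "\<And>g h. g \<in> carrier G \<Longrightarrow> h \<in> carrier G \<Longrightarrow> R (g \<otimes> h) = R g * R h"
    and fin: "finite (carrier G)"
  shows "(\<Sum>V\<in>Irr G. cmod (of_nat (irr_dim V) / of_nat (card (carrier G)) *
           (\<Sum>g\<in>carrier G. irr_char V (inv g) * mat_trace (R g)))) \<le> real m"
proof (cases "finite (Irr G)")
  case finI: True
  define c where "c V = (of_nat (irr_dim V) / of_nat (card (carrier G)) :: complex)" for V :: "(nat \<times> ('a \<Rightarrow> complex mat)) set"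
  \<comment> \<open>the projection onto the \<open>V\<close>-isotypic component\<close>
  define E where "E V = mat m m (\<lambda>(i, j). c V * (\<Sum>g\<in>carrier G. irr_char V (inv g) * R g $$ (i, j)))" for V
  have E: "E V \<in> carrier_mat m m" for V unfolding E_def by simp
  have ord: "of_nat (card (carrier G)) \<noteq> (0 :: complex)"
    using fin by auto
  have EE: "E V * E W = (if V = W then E V else 0\<^sub>m m m)" if V: "V \<in> Irr G" and W: "W \<in> Irr G" for V W
  proof (rule eq_matI)
    fix i j assume "i < dim_row (if V = W then E V else 0\<^sub>m m m)" "j < dim_col (if V = W then E V else 0\<^sub>m m m)"
    then have ij: "i < m" "j < m" using E[of V] by (auto split: if_splits)
    have "(E V * E W) $$ (i, j) = (\<Sum>a<m. \<Sum>g\<in>carrier G. \<Sum>h\<in>carrier G.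
        c V * c W * (irr_char V (inv g) * irr_char W (inv h)) * (R g $$ (i, a) * R h $$ (a, j)))"
      unfolding mult_mat_entry[OF E E ij]
    proof (rule sum.cong[OF refl])
      fix a assume "a \<in> {..<m}"
      then have "E V $$ (i, a) = (\<Sum>g\<in>carrier G. c V * (irr_char V (inv g) * R g $$ (i, a)))"
        "E W $$ (a, j) = (\<Sum>h\<in>carrier G. c W * (irr_char W (inv h) * R h $$ (a, j)))"
        using ij by (simp_all add: E_def sum_distrib_left)
      then show "E V $$ (i, a) * E W $$ (a, j) = (\<Sum>g\<in>carrier G. \<Sum>h\<in>carrier G.
        c V * c W * (irr_char V (inv g) * irr_char W (inv h)) * (R g $$ (i, a) * R h $$ (a, j)))"
        by (simp only: sum_product) (simp add: mult_ac)
    qed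
    also have "\<dots> = (\<Sum>g\<in>carrier G. \<Sum>h\<in>carrier G.
        c V * c W * (irr_char V (inv g) * irr_char W (inv h)) * (\<Sum>a<m. R g $$ (i, a) * R h $$ (a, j)))"
      unfolding sum_distrib_left
      by (subst sum.swap, rule sum.cong[OF refl], subst sum.swap, rule refl)
    also have "\<dots> = (\<Sum>g\<in>carrier G. \<Sum>h\<in>carrier G.
        c V * c W * (irr_char V (inv g) * irr_char W (inv h)) * R (g \<otimes> h) $$ (i, j))"
      by (intro sum.cong refl)
        (simp add: mult mult_mat_entry[OF R R ij] del: index_mult_mat)
    also have "\<dots> = (\<Sum>g\<in>carrier G. \<Sum>k\<in>carrier G.
        c V * c W * (irr_char V (inv g) * irr_char W (inv k \<otimes> g)) * R k $$ (i, j))"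
    proof (rule sum.cong[OF refl])
      fix g assume g: "g \<in> carrier G"
      show "(\<Sum>h\<in>carrier G. c V * c W * (irr_char V (inv g) * irr_char W (inv h)) * R (g \<otimes> h) $$ (i, j))
        = (\<Sum>k\<in>carrier G. c V * c W * (irr_char V (inv g) * irr_char W (inv k \<otimes> g)) * R k $$ (i, j))"
        by (subst sum_translate[OF g, symmetric], rule sum.cong[OF refl])
          (simp add: g inv_mult_group m_assoc)
    qed
    also have "\<dots> = (\<Sum>k\<in>carrier G. c V * c W *
        (\<Sum>g\<in>carrier G. irr_char V (inv g) * irr_char W (inv k \<otimes> g)) * R k $$ (i, j))"
      by (subst sum.swap) (simp add: sum_distrib_left sum_distrib_right)
    also have "\<dots> = (\<Sum>k\<in>carrier G. if V = W then c V * (irr_char V (inv k) * R k $$ (i, j)) else 0)"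
    proof (rule sum.cong[OF refl])
      fix k assume k: "k \<in> carrier G"
      have "irr_dim V > 0" using Irr_representative(2)[OF V] by (simp add: irreducible_rep_def)
      then show "c V * c W * (\<Sum>g\<in>carrier G. irr_char V (inv g) * irr_char W (inv k \<otimes> g)) * R k $$ (i, j)
        = (if V = W then c V * (irr_char V (inv k) * R k $$ (i, j)) else 0)"
        using ord unfolding irr_char_convolution[OF V W k] by (auto simp: c_def field_simps)
    qed
    also have "\<dots> = (if V = W then E V else 0\<^sub>m m m) $$ (i, j)"
      using ij by (simp add: E_def sum_distrib_left)
    finally show "(E V * E W) $$ (i, j) = (if V = W then E V else 0\<^sub>m m m) $$ (i, j)" .
  qed (use E in auto)
  have trE: "mat_trace (E V) = c V * (\<Sum>g\<in>carrier G. irr_char V (inv g) * mat_trace (R g))" for V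
  proof -
    have "mat_trace (E V) = (\<Sum>i<m. \<Sum>g\<in>carrier G. c V * (irr_char V (inv g) * R g $$ (i, i)))"
      by (simp add: mat_trace_def E_def sum_distrib_left)
    also have "\<dots> = (\<Sum>g\<in>carrier G. \<Sum>i<m. c V * (irr_char V (inv g) * R g $$ (i, i)))"
      by (rule sum.swap)
    also have "\<dots> = (\<Sum>g\<in>carrier G. c V * (irr_char V (inv g) * mat_trace (R g)))"
      using R by (intro sum.cong refl) (simp add: mat_trace_def sum_distrib_left carrier_matD(1)[OF R])
    finally show ?thesis by (simp add: sum_distrib_left)
  qed
  define P where "P = mat m m (\<lambda>ij. \<Sum>V\<in>Irr G. E V $$ ij)"
  have P: "P \<in> carrier_mat m m" unfolding P_def by simp
  have "P * P = P"
  proof (rule eq_matI)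
    fix i j assume "i < dim_row P" "j < dim_col P"
    then have ij: "i < m" "j < m" using P by auto
    have "(P * P) $$ (i, j) = (\<Sum>a<m. \<Sum>V\<in>Irr G. \<Sum>W\<in>Irr G. E V $$ (i, a) * E W $$ (a, j))"
      unfolding mult_mat_entry[OF P P ij] by (intro sum.cong refl) (simp add: P_def ij sum_product)
    also have "\<dots> = (\<Sum>V\<in>Irr G. \<Sum>W\<in>Irr G. \<Sum>a<m. E V $$ (i, a) * E W $$ (a, j))"
      by (subst sum.swap, rule sum.cong[OF refl], subst sum.swap, rule refl)
    also have "\<dots> = (\<Sum>V\<in>Irr G. \<Sum>W\<in>Irr G. if V = W then E V $$ (i, j) else 0)"
      by (intro sum.cong refl) (simp add: mult_mat_entry[OF E E ij, symmetric] EE ij del: index_mult_mat)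
    also have "\<dots> = P $$ (i, j)" using finI by (simp add: P_def ij)
    finally show "(P * P) $$ (i, j) = P $$ (i, j)" .
  qed (use P in auto)
  from mat_trace_idempotent[OF P this] obtain k where k: "k \<le> m" "mat_trace P = of_nat k" by auto
  have "\<exists>l. mat_trace (E V) = of_nat l" if "V \<in> Irr G" for V
    using mat_trace_idempotent[OF E, of V] EE[OF that that] by auto
  then have "\<forall>V. \<exists>l. V \<in> Irr G \<longrightarrow> mat_trace (E V) = of_nat l" by blast
  from choice[OF this] obtain l where l: "\<And>V. V \<in> Irr G \<Longrightarrow> mat_trace (E V) = of_nat (l V)" by blast
  have "(\<Sum>V\<in>Irr G. cmod (mat_trace (E V))) = real (\<Sum>V\<in>Irr G. l V)"
    unfolding of_nat_sum by (intro sum.cong refl) (simp add: l)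
  also have "complex_of_nat (\<Sum>V\<in>Irr G. l V) = (\<Sum>V\<in>Irr G. mat_trace (E V))"
    by (simp add: l)
  then have "complex_of_nat (\<Sum>V\<in>Irr G. l V) = mat_trace P"
    by (simp add: mat_trace_def P_def carrier_matD(1)[OF E] sum.swap[of _ "{..<m}"])
  then have "(\<Sum>V\<in>Irr G. l V) = k" unfolding k(2) of_nat_eq_iff .
  finally show ?thesis using k(1) unfolding trE c_def by simp
qed simp

end

section \<open>Faces of the braid arrangement\<close>

text \<open>A face of the braid arrangement is an ordered set partition of \<open>{1..n}\<close>. It is encoded as the
  total preorder in which \<open>(a, b)\<close> says that the block of \<open>a\<close> does not come after the block of \<open>b\<close>;
  this turns the statements about products and about the action of permutations into pure logic.\<close>

definition faces :: "nat \<Rightarrow> (nat \<times> nat) set set" where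
  "faces n = {F. F \<subseteq> {1..n} \<times> {1..n} \<and> trans F \<and>
     (\<forall>a\<in>{1..n}. \<forall>b\<in>{1..n}. (a, b) \<in> F \<or> (b, a) \<in> F)}"

text \<open>The Tits product: refine \<open>F\<close> by breaking its ties according to \<open>H\<close>.\<close>

definition face_mult :: "(nat \<times> nat) set \<Rightarrow> (nat \<times> nat) set \<Rightarrow> (nat \<times> nat) set" where
  "face_mult F H = {(a, b). (a, b) \<in> F \<and> ((b, a) \<in> F \<longrightarrow> (a, b) \<in> H)}"

definition act :: "(nat \<Rightarrow> nat) \<Rightarrow> (nat \<times> nat) set \<Rightarrow> (nat \<times> nat) set" where
  "act g F = map_prod g g ` F"

definition base_chamber :: "nat \<Rightarrow> (nat \<times> nat) set" where
  "base_chamber n = {(i, j). i \<in> {1..n} \<and> j \<in> {1..n} \<and> i \<le> j}"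

text \<open>The face whose blocks are the orbits of \<open>S\<^sub>N\<close>, in their natural order. A pair \<open>(i, j)\<close> with
  \<open>j < i\<close> is tied exactly when all simple roots between \<open>j\<close> and \<open>i\<close> lie in \<open>N\<close>.\<close>

definition std_face :: "nat \<Rightarrow> (nat \<times> nat) set \<Rightarrow> (nat \<times> nat) set" where
  "std_face n N = {(i, j). i \<in> {1..n} \<and> j \<in> {1..n} \<and>
     (i \<le> j \<or> (\<forall>k. j \<le> k \<longrightarrow> k < i \<longrightarrow> (k, Suc k) \<in> N))}"

lemma facesD:
  assumes "F \<in> faces n"
  shows "F \<subseteq> {1..n} \<times> {1..n}" "(a, b) \<in> F \<Longrightarrow> (b, c) \<in> F \<Longrightarrow> (a, c) \<in> F"
    "a \<in> {1..n} \<Longrightarrow> b \<in> {1..n} \<Longrightarrow> (a, b) \<in> F \<or> (b, a) \<in> F"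
  using assms unfolding faces_def trans_def by blast+

lemma facesI:
  assumes "F \<subseteq> {1..n} \<times> {1..n}" "\<And>a b c. (a, b) \<in> F \<Longrightarrow> (b, c) \<in> F \<Longrightarrow> (a, c) \<in> F"
    "\<And>a b. a \<in> {1..n} \<Longrightarrow> b \<in> {1..n} \<Longrightarrow> (a, b) \<in> F \<or> (b, a) \<in> F"
  shows "F \<in> faces n"
  using assms unfolding faces_def trans_def by blast

lemma finite_faces: "finite (faces n)"
  by (rule finite_subset[of _ "Pow ({1..n} \<times> {1..n})"]) (auto simp: faces_def)

lemma act_comp: "act (g \<circ> h) F = act g (act h F)"
  by (auto simp: act_def image_image map_prod_def split_beta)

lemma act_id: "act id F = F" "act (\<lambda>x. x) F = F"
  by (auto simp: act_def map_prod_def image_iff)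

lemma mem_act_iff:
  assumes "g permutes S"
  shows "(g a, g b) \<in> act g F \<longleftrightarrow> (a, b) \<in> F"
  using permutes_inj[OF assms] by (auto simp: act_def inj_eq)

lemma mem_act_inv_iff:
  assumes "g permutes S"
  shows "(a, b) \<in> act g F \<longleftrightarrow> (inv' g a, inv' g b) \<in> F"
  using mem_act_iff[OF assms, of "inv' g a" "inv' g b" F] permutes_inverses[OF assms] by simp

lemma act_inv:
  assumes "g permutes S"
  shows "act (inv' g) (act g F) = F" "act g (act (inv' g) F) = F"
  unfolding act_comp[symmetric] permutes_inv_o[OF assms] by (simp_all add: act_id)

lemma act_eq_iff:
  assumes "g permutes S"
  shows "act g F = act g H \<longleftrightarrow> F = H"
  using act_inv(1)[OF assms] by metis

lemma act_faces:
  assumes g: "g permutes {1..n}" and F: "F \<in> faces n"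
  shows "act g F \<in> faces n"
proof (rule facesI)
  note inv_in = permutes_in_image[OF permutes_inv[OF g]]
  show "act g F \<subseteq> {1..n} \<times> {1..n}"
    using facesD(1)[OF F] permutes_in_image[OF g] by (auto simp: act_def)
  show "(a, c) \<in> act g F" if "(a, b) \<in> act g F" "(b, c) \<in> act g F" for a b c
    using that facesD(2)[OF F] unfolding mem_act_inv_iff[OF g] by blast
  show "(a, b) \<in> act g F \<or> (b, a) \<in> act g F" if "a \<in> {1..n}" "b \<in> {1..n}" for a b
    using that facesD(3)[OF F, of "inv' g a" "inv' g b"] inv_in unfolding mem_act_inv_iff[OF g] by blast
qed

lemma face_mult_faces:
  assumes F: "F \<in> faces n" and H: "H \<in> faces n"
  shows "face_mult F H \<in> faces n"
proof (rule facesI)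
  show "face_mult F H \<subseteq> {1..n} \<times> {1..n}" using facesD(1)[OF F] by (auto simp: face_mult_def)
  show "(a, c) \<in> face_mult F H" if "(a, b) \<in> face_mult F H" "(b, c) \<in> face_mult F H" for a b c
    using that facesD(2)[OF F] facesD(2)[OF H] unfolding face_mult_def by blast
  show "(a, b) \<in> face_mult F H \<or> (b, a) \<in> face_mult F H" if "a \<in> {1..n}" "b \<in> {1..n}" for a b
    using that facesD(3)[OF F, of a b] facesD(3)[OF H, of a b] unfolding face_mult_def by blast
qed

lemma face_mult_assoc: "face_mult (face_mult F H) K = face_mult F (face_mult H K)"
  unfolding face_mult_def by blast

lemma act_face_mult:
  assumes "g permutes S"
  shows "act g (face_mult F H) = face_mult (act g F) (act g H)"
  by (auto simp: face_mult_def mem_act_inv_iff[OF assms])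

text \<open>A permutation of finite order cannot move an element strictly up or strictly down in a preorder
  that it preserves. So it preserves every block, and not just the set of blocks.\<close>

lemma fixed_face_blocks:
  assumes g: "g permutes {1..n}" and P: "P \<in> faces n" and fixed: "act g P = P" and a: "a \<in> {1..n}"
  shows "(a, g a) \<in> P \<and> (g a, a) \<in> P"
proof -
  have ga: "g a \<in> {1..n}" using a permutes_in_image[OF g] by blast
  have refl: "(g a, g a) \<in> P" using facesD(3)[OF P ga ga] by blast
  have step: "(x, y) \<in> P \<Longrightarrow> (g x, g y) \<in> P" for x y
    using mem_act_iff[OF g, of x y P] fixed by simp
  have "permutation g" using g permutation_permutes by blast
  then obtain k where k: "g ^^ k = id" "k > 0" using permutation_is_nilpotent by blast
  \<comment> \<open>if \<open>g\<close> moves \<open>a\<close> up, it keeps moving up until it returns to \<open>a\<close>, so it was a tie; dually for down\<close>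
  have up: "(g a, (g ^^ Suc i) a) \<in> P" if "(a, g a) \<in> P" for i
  proof (induction i)
    case (Suc i)
    have "((g ^^ i) x, (g ^^ i) y) \<in> P" if "(x, y) \<in> P" for x y i
      using that step by (induction i) auto
    from this[OF that, of "Suc i"] have "((g ^^ Suc i) a, (g ^^ Suc (Suc i)) a) \<in> P"
      by (simp add: funpow_swap1)
    with Suc show ?case using facesD(2)[OF P] by blast
  qed (use refl in simp)
  have down: "((g ^^ Suc i) a, g a) \<in> P" if "(g a, a) \<in> P" for i
  proof (induction i)
    case (Suc i)
    have "((g ^^ i) x, (g ^^ i) y) \<in> P" if "(x, y) \<in> P" for x y i
      using that step by (induction i) auto
    from this[OF that, of "Suc i"] have "((g ^^ Suc (Suc i)) a, (g ^^ Suc i) a) \<in> P"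
      by (simp add: funpow_swap1)
    with Suc show ?case using facesD(2)[OF P] by blast
  qed (use refl in simp)
  have "(g ^^ Suc (k - 1)) a = a" using k by simp
  with up[of "k - 1"] down[of "k - 1"] facesD(3)[OF P a ga] show ?thesis by auto
qed

text \<open>The blocks of the product are intersections of a block of \<open>F\<close> and a block of \<open>H\<close>. A permutation
  that preserves each of these preserves each block of \<open>F\<close> and of \<open>H\<close>, since those are unions of them. This
  is the reason why counting fixed faces is multiplicative.\<close>

lemma act_face_mult_fixed_iff:
  assumes g: "g permutes {1..n}" and F: "F \<in> faces n" and H: "H \<in> faces n"
  shows "act g (face_mult F H) = face_mult F H \<longleftrightarrow> act g F = F \<and> act g H = H"
proof
  assume fixed: "act g (face_mult F H) = face_mult F H"
  have tie: "(a, g a) \<in> F \<and> (g a, a) \<in> F \<and> (a, g a) \<in> H \<and> (g a, a) \<in> H" if "a \<in> {1..n}" for a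
    using fixed_face_blocks[OF g face_mult_faces[OF F H] fixed that] by (auto simp: face_mult_def)
  have "act g K = K" if K: "K \<in> faces n"
    and t: "\<And>a. a \<in> {1..n} \<Longrightarrow> (a, g a) \<in> K \<and> (g a, a) \<in> K" for K
  proof -
    have "(a, b) \<in> K \<longleftrightarrow> (g a, g b) \<in> K" if "a \<in> {1..n}" "b \<in> {1..n}" for a b
      using t[OF that(1)] t[OF that(2)] facesD(2)[OF K] by blast
    then have *: "(a, b) \<in> K \<longleftrightarrow> (g a, g b) \<in> K" for a b
      using facesD(1)[OF K] permutes_in_image[OF g] by blast
    have "(a, b) \<in> act g K \<longleftrightarrow> (a, b) \<in> K" for a b
      unfolding mem_act_inv_iff[OF g] *[of "inv' g a" "inv' g b"] permutes_inverses[OF g] by (rule refl)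
    then show ?thesis by auto
  qed
  with tie F H show "act g F = F \<and> act g H = H" by blast
next
  assume "act g F = F \<and> act g H = H"
  then show "act g (face_mult F H) = face_mult F H" by (simp add: act_face_mult[OF g])
qed

lemma base_chamber_face: "base_chamber n \<in> faces n"
  by (rule facesI) (auto simp: base_chamber_def)

lemma std_face_face: "std_face n N \<in> faces n"
proof (rule facesI)
  fix a b c assume ab: "(a, b) \<in> std_face n N" and bc: "(b, c) \<in> std_face n N"
  have "(k, Suc k) \<in> N" if "c \<le> k" "k < a" for k
  proof (cases "b \<le> k")
    case True
    then show ?thesis using ab that by (auto simp: std_face_def)
  next
    case False
    then show ?thesis using bc that by (auto simp: std_face_def)
  qed
  then show "(a, c) \<in> std_face n N" using ab bc by (auto simp: std_face_def)
qed (auto simp: std_face_def)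

text \<open>The permutation can be read off from the linear order: \<open>inv' g a\<close> is the number of elements
  up to \<open>a\<close>.\<close>

lemma act_base_chamber_inj:
  assumes g: "g permutes {1..n}" and h: "h permutes {1..n}"
    and eq: "act g (base_chamber n) = act h (base_chamber n)"
  shows "g = h"
proof -
  have card: "card {b. (b, a) \<in> act g (base_chamber n)} = inv' g a"
    if g: "g permutes {1..n}" and a: "a \<in> {1..n}" for g a
  proof -
    have i: "inv' g a \<in> {1..n}" using a permutes_in_image[OF permutes_inv[OF g]] by blast
    have "{b. (b, a) \<in> act g (base_chamber n)} = {b. inv' g b \<in> {1..inv' g a}}"
      unfolding mem_act_inv_iff[OF g] using i by (auto simp: base_chamber_def)
    also have "\<dots> = g ` {1..inv' g a}"
    proof (intro equalityI subsetI)
      fix b assume "b \<in> {b. inv' g b \<in> {1..inv' g a}}"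
      then have "g (inv' g b) \<in> g ` {1..inv' g a}" by blast
      then show "b \<in> g ` {1..inv' g a}" by (simp only: permutes_inverses(1)[OF g])
    next
      fix b assume "b \<in> g ` {1..inv' g a}"
      then obtain c where "b = g c" "c \<in> {1..inv' g a}" by blast
      then show "b \<in> {b. inv' g b \<in> {1..inv' g a}}"
        using permutes_inverses(2)[OF g, of c] by simp
    qed
    also have "card \<dots> = inv' g a"
      using permutes_inj_on[OF g] by (simp add: card_image)
    finally show ?thesis .
  qed
  have "inv' g a = inv' h a" for a
  proof (cases "a \<in> {1..n}")
    case True
    then show ?thesis using card[OF g True] card[OF h True] eq by simp
  next
    case False
    then show ?thesis
      using permutes_not_in[OF permutes_inv[OF g]] permutes_not_in[OF permutes_inv[OF h]] by simp
  qed
  then have "inv' (inv' g) = inv' (inv' h)" by presburger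
  then show ?thesis unfolding permutes_inv_inv[OF g] permutes_inv_inv[OF h] .
qed

lemma linear_order_is_chamber:
  assumes L: "L \<in> faces n" and anti: "\<And>a b. (a, b) \<in> L \<Longrightarrow> (b, a) \<in> L \<Longrightarrow> a = b"
  shows "\<exists>w. w permutes {1..n} \<and> L = act w (base_chamber n)"
proof -
  \<comment> \<open>the position of \<open>a\<close> in the linear order, extended by the identity to a permutation\<close>
  define rank where "rank a = (if a \<in> {1..n} then card {b. (b, a) \<in> L} else a)" for a
  have fin: "finite {b. (b, a) \<in> L}" for a
  proof (rule finite_subset)
    show "{b. (b, a) \<in> L} \<subseteq> {1..n}" using facesD(1)[OF L] by blast
  qed simp
  have refl: "(a, a) \<in> L" if "a \<in> {1..n}" for a using facesD(3)[OF L that that] by blast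
  have le: "(a, b) \<in> L \<longleftrightarrow> rank a \<le> rank b" if ab: "a \<in> {1..n}" "b \<in> {1..n}" for a b
  proof
    assume "(a, b) \<in> L"
    then have "{c. (c, a) \<in> L} \<subseteq> {c. (c, b) \<in> L}" using facesD(2)[OF L] by blast
    then show "rank a \<le> rank b" using ab fin by (simp add: rank_def card_mono)
  next
    assume le: "rank a \<le> rank b"
    show "(a, b) \<in> L"
    proof (rule ccontr)
      assume n: "(a, b) \<notin> L"
      then have "(b, a) \<in> L" using facesD(3)[OF L ab] by blast
      then have "{c. (c, b) \<in> L} \<subset> {c. (c, a) \<in> L}"
        using facesD(2)[OF L] n refl[OF ab(1)] by blast
      then have "card {c. (c, b) \<in> L} < card {c. (c, a) \<in> L}" by (rule psubset_card_mono[OF fin])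
      then show False using le ab by (simp add: rank_def)
    qed
  qed
  have in_range: "rank a \<in> {1..n}" if a: "a \<in> {1..n}" for a
  proof -
    have "card {b. (b, a) \<in> L} \<le> card {1..n}"
    proof (rule card_mono)
      show "{b. (b, a) \<in> L} \<subseteq> {1..n}" using facesD(1)[OF L] by blast
    qed simp
    moreover have "card {b. (b, a) \<in> L} > 0"
      using refl[OF a] fin[of a] by (auto simp: card_gt_0_iff)
    ultimately show ?thesis using a by (simp add: rank_def)
  qed
  have "inj_on rank {1..n}"
  proof (rule inj_onI)
    fix a b assume ab: "a \<in> {1..n}" "b \<in> {1..n}" and "rank a = rank b"
    then have "(a, b) \<in> L" "(b, a) \<in> L" using le[OF ab] le[OF ab(2,1)] by simp_all
    then show "a = b" by (rule anti)
  qed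
  moreover from this have "rank ` {1..n} = {1..n}"
    using in_range by (intro endo_inj_surj) auto
  ultimately have "bij_betw rank {1..n} {1..n}" by (simp add: bij_betw_def)
  then have perm: "rank permutes {1..n}"
    by (rule bij_imp_permutes) (simp only: rank_def if_False)
  have "(a, b) \<in> act (inv' rank) (base_chamber n) \<longleftrightarrow> (a, b) \<in> L" for a b
  proof (cases "a \<in> {1..n} \<and> b \<in> {1..n}")
    case True
    then show ?thesis using le[of a b] in_range[of a] in_range[of b]
      unfolding mem_act_inv_iff[OF permutes_inv[OF perm]] permutes_inv_inv[OF perm]
      by (simp add: base_chamber_def)
  next
    case False
    moreover have "(rank a, rank b) \<notin> base_chamber n"
      using False permutes_in_image[OF perm, of a] permutes_in_image[OF perm, of b]
      unfolding base_chamber_def by blast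
    ultimately show ?thesis using facesD(1)[OF L]
      unfolding mem_act_inv_iff[OF permutes_inv[OF perm]] permutes_inv_inv[OF perm] by blast
  qed
  then have "L = act (inv' rank) (base_chamber n)" by auto
  with permutes_inv[OF perm] show ?thesis by blast
qed

lemma X_set_iff:
  assumes "N \<subseteq> simple_roots n"
  shows "w \<in> X_set n N \<longleftrightarrow> w permutes {1..n} \<and> (\<forall>i. (i, Suc i) \<in> N \<longrightarrow> w i < w (Suc i))"
proof (cases "w permutes {1..n}")
  case w: True
  have "(i, Suc i) \<notin> descent_set n w \<longleftrightarrow> w i < w (Suc i)" if "(i, Suc i) \<in> N" for i
  proof -
    have i: "i \<in> {1..n}" "Suc i \<in> {1..n}" "(i, Suc i) \<in> simple_roots n"
      using that assms by (auto simp: simple_roots_def)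
    then have "w i \<in> {1..n}" "w (Suc i) \<in> {1..n}" "w i \<noteq> w (Suc i)"
      using permutes_in_image[OF w] permutes_inj[OF w] by (blast, blast, simp add: inj_eq)
    then show ?thesis using i by (auto simp: descent_set_def negative_roots_def)
  qed
  moreover have "descent_set n w \<inter> N = {} \<longleftrightarrow> (\<forall>i. (i, Suc i) \<in> N \<longrightarrow> (i, Suc i) \<notin> descent_set n w)"
    using assms by (auto simp: simple_roots_def)
  ultimately show ?thesis using w by (auto simp: X_set_def sym_group_carrier)
qed (auto simp: X_set_def sym_group_carrier)

text \<open>Multiplying a face by the base chamber sorts each block increasingly, and the increasing
  arrangements of the blocks are exactly the elements of \<open>X_set n N\<close>. This links descent sets with faces.\<close>

lemma std_face_chamber:
  assumes N: "N \<subseteq> simple_roots n" and w: "w \<in> X_set n N"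
  shows "face_mult (act w (std_face n N)) (base_chamber n) = act w (base_chamber n)"
proof -
  have perm: "w permutes {1..n}" and inc: "\<And>i. (i, Suc i) \<in> N \<Longrightarrow> w i < w (Suc i)"
    using w X_set_iff[OF N] by auto
  have mono: "w i < w j" if "i < j" "\<And>k. i \<le> k \<Longrightarrow> k < j \<Longrightarrow> (k, Suc k) \<in> N" for i j
    using that
  proof (induction j)
    case (Suc j)
    then show ?case using inc[of j] by (cases "i = j") force+
  qed simp
  have "(w i, w j) \<in> face_mult (act w (std_face n N)) (base_chamber n) \<longleftrightarrow> (i, j) \<in> base_chamber n" for i j
  proof (cases "i \<in> {1..n} \<and> j \<in> {1..n}")
    case False
    then show ?thesis unfolding face_mult_def mem_Collect_eq prod.case mem_act_iff[OF perm]
      by (auto simp: std_face_def base_chamber_def)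
  next
    case ij: True
    then have wij: "w i \<in> {1..n}" "w j \<in> {1..n}" using permutes_in_image[OF perm] by blast+
    consider "i = j" | "i < j" | "j < i" by linarith
    then show ?thesis
    proof cases
      case 1
      then show ?thesis unfolding face_mult_def mem_Collect_eq prod.case mem_act_iff[OF perm]
        using ij wij by (auto simp: std_face_def base_chamber_def)
    next
      case 2
      then show ?thesis unfolding face_mult_def mem_Collect_eq prod.case mem_act_iff[OF perm]
        using ij wij mono[OF 2] by (auto simp: std_face_def base_chamber_def intro: less_imp_le)
    next
      case 3
      then show ?thesis unfolding face_mult_def mem_Collect_eq prod.case mem_act_iff[OF perm]
        using ij wij mono[OF 3] by (auto simp: std_face_def base_chamber_def)
    qed
  qed
  from this[of "inv' w a" "inv' w b" for a b] show ?thesis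
    unfolding permutes_inverses[OF perm] mem_act_inv_iff[OF perm, symmetric] by auto
qed

text \<open>Listing \<open>{1..n}\<close> in an order compatible with \<open>F\<close>, the blocks of \<open>F\<close> become intervals, and
  an interval of positions is determined by the adjacent ties in it.\<close>

lemma face_containing_chamber:
  assumes F: "F \<in> faces n" and w: "w permutes {1..n}" and sub: "act w (base_chamber n) \<subseteq> F"
  defines "N \<equiv> {(i, Suc i) | i. 1 \<le> i \<and> i < n \<and> (w (Suc i), w i) \<in> F}"
  shows "F = act w (std_face n N)"
proof -
  have leF: "(w i, w j) \<in> F" if "i \<in> {1..n}" "j \<in> {1..n}" "i \<le> j" for i j
  proof -
    have "(w i, w j) \<in> act w (base_chamber n)"
      using that unfolding mem_act_iff[OF w] by (simp add: base_chamber_def)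
    with sub show ?thesis by blast
  qed
  have "(w i, w j) \<in> F \<longleftrightarrow> (i, j) \<in> std_face n N" for i j
  proof (cases "i \<in> {1..n} \<and> j \<in> {1..n}")
    case False
    then show ?thesis
      using facesD(1)[OF F] permutes_in_image[OF w] by (auto simp: std_face_def)
  next
    case ij: True
    show ?thesis
    proof (cases "i \<le> j")
      case True
      then show ?thesis using ij leF[of i j] by (auto simp: std_face_def)
    next
      case False
      have "(w i, w j) \<in> F \<longleftrightarrow> (\<forall>k. j \<le> k \<longrightarrow> k < i \<longrightarrow> (k, Suc k) \<in> N)"
      proof
        assume F1: "(w i, w j) \<in> F"
        show "\<forall>k. j \<le> k \<longrightarrow> k < i \<longrightarrow> (k, Suc k) \<in> N"
        proof (intro allI impI)
          fix k assume k: "j \<le> k" "k < i"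
          then have "(w (Suc k), w i) \<in> F" "(w j, w k) \<in> F"
            using ij by (auto intro!: leF)
          then have "(w (Suc k), w k) \<in> F" using F1 facesD(2)[OF F] by blast
          then show "(k, Suc k) \<in> N" using k ij by (auto simp: N_def)
        qed
      next
        assume *: "\<forall>k. j \<le> k \<longrightarrow> k < i \<longrightarrow> (k, Suc k) \<in> N"
        have "(w (j + m), w j) \<in> F" if "j + m \<le> i" for m
          using that
        proof (induction m)
          case 0
          then show ?case using ij leF[of j j] by simp
        next
          case (Suc m)
          then have "(j + m, Suc (j + m)) \<in> N" using * by simp
          then have "(w (Suc (j + m)), w (j + m)) \<in> F" by (simp add: N_def)
          then show ?case using Suc facesD(2)[OF F] by auto
        qed
        from this[of "i - j"] show "(w i, w j) \<in> F" using False by simp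
      qed
      then show ?thesis using False ij by (auto simp: std_face_def)
    qed
  qed
  from this[of "inv' w a" "inv' w b" for a b] show "F = act w (std_face n N)"
    unfolding permutes_inverses[OF w] mem_act_inv_iff[OF w, symmetric] by auto
qed

text \<open>Together with \<open>face_decomposition_unique\<close> below, this parametrizes the faces by the pairs of a
  set \<open>N\<close> of simple roots and a permutation without descents in \<open>N\<close>.\<close>

lemma face_decomposition:
  assumes F: "F \<in> faces n"
  shows "\<exists>N w. N \<subseteq> simple_roots n \<and> w \<in> X_set n N \<and> F = act w (std_face n N)"
proof -
  define L where "L = face_mult F (base_chamber n)"
  have "L \<in> faces n" unfolding L_def by (rule face_mult_faces[OF F base_chamber_face])
  moreover have "a = b" if "(a, b) \<in> L" "(b, a) \<in> L" for a b
    using that by (auto simp: L_def face_mult_def base_chamber_def)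
  ultimately obtain w where w: "w permutes {1..n}" and L: "L = act w (base_chamber n)"
    using linear_order_is_chamber by blast
  \<comment> \<open>within a block, the base chamber makes \<open>w\<close> increasing, so no element of \<open>N\<close> is a descent\<close>
  define N where "N = {(i, Suc i) | i. 1 \<le> i \<and> i < n \<and> (w (Suc i), w i) \<in> F}"
  have N: "N \<subseteq> simple_roots n" by (auto simp: N_def simple_roots_def)
  have le: "(w i, w j) \<in> L" if "i \<in> {1..n}" "j \<in> {1..n}" "i \<le> j" for i j
    using that unfolding L mem_act_iff[OF w] by (simp add: base_chamber_def)
  have "w i < w (Suc i)" if "(i, Suc i) \<in> N" for i
  proof -
    have i: "i \<in> {1..n}" "Suc i \<in> {1..n}" "(w (Suc i), w i) \<in> F" using that by (auto simp: N_def)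
    then have "(w i, w (Suc i)) \<in> base_chamber n"
      using le[of i "Suc i"] by (auto simp: L_def face_mult_def)
    moreover have "w i \<noteq> w (Suc i)" using permutes_inj[OF w] by (simp add: inj_eq)
    ultimately show ?thesis by (auto simp: base_chamber_def)
  qed
  then have X: "w \<in> X_set n N" using X_set_iff[OF N] w by blast
  have "act w (base_chamber n) \<subseteq> F" unfolding L[symmetric] L_def face_mult_def by blast
  from face_containing_chamber[OF F w this] have "F = act w (std_face n N)" unfolding N_def .
  with N X show ?thesis by blast
qed

lemma std_face_inj:
  assumes N: "N \<subseteq> simple_roots n" and M: "M \<subseteq> simple_roots n" and eq: "std_face n N = std_face n M"
  shows "N = M"
proof -
  have "(i, Suc i) \<in> N \<longleftrightarrow> (Suc i, i) \<in> std_face n N" if "N \<subseteq> simple_roots n" for i N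
  proof -
    have "(\<forall>k. i \<le> k \<longrightarrow> k < Suc i \<longrightarrow> (k, Suc k) \<in> N) \<longleftrightarrow> (i, Suc i) \<in> N"
      by (metis le_antisym less_Suc_eq_le order_refl lessI)
    then show ?thesis using that by (auto simp: std_face_def simple_roots_def)
  qed
  from this[OF N] this[OF M] eq have "(i, Suc i) \<in> N \<longleftrightarrow> (i, Suc i) \<in> M" for i by simp
  then show ?thesis using N M unfolding simple_roots_def by blast
qed

lemma face_decomposition_unique:
  assumes N: "N \<subseteq> simple_roots n" and w: "w \<in> X_set n N"
    and M: "M \<subseteq> simple_roots n" and v: "v \<in> X_set n M"
    and eq: "act w (std_face n N) = act v (std_face n M)"
  shows "w = v \<and> N = M"
proof -
  have p: "w permutes {1..n}" "v permutes {1..n}"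
    using X_set_iff[OF N] X_set_iff[OF M] w v by auto
  have "act w (base_chamber n) = act v (base_chamber n)"
    using std_face_chamber[OF N w] std_face_chamber[OF M v] eq by simp
  then have "w = v" by (rule act_base_chamber_inj[OF p])
  moreover have "std_face n N = std_face n M" using eq act_eq_iff[OF p(1)] \<open>w = v\<close> by simp
  ultimately show ?thesis using std_face_inj[OF N M] by simp
qed

section \<open>Parabolic subgroups as stabilizers of faces\<close>

lemma transpose_fixes_std_face:
  assumes "(k, Suc k) \<in> N" and N: "N \<subseteq> simple_roots n"
  shows "act (Transposition.transpose k (Suc k)) (std_face n N) = std_face n N"
proof -
  let ?s = "Transposition.transpose k (Suc k)"
  have k: "k \<in> {1..n}" "Suc k \<in> {1..n}" using assms by (auto simp: simple_roots_def)
  have s: "?s permutes {1..n}" using k by (rule permutes_swap_id)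
  have up: "(k, Suc k) \<in> std_face n N" using k by (auto simp: std_face_def)
  have "(Suc k, k) \<in> std_face n N" using k assms(1)
    by (auto simp: std_face_def) (metis le_less_Suc_eq less_antisym)
  with up k have tie: "(a, ?s a) \<in> std_face n N \<and> (?s a, a) \<in> std_face n N" if "a \<in> {1..n}" for a
    using facesD(3)[OF std_face_face[of n N] that that] by (auto simp: Transposition.transpose_def)
  have *: "(a, b) \<in> std_face n N \<longleftrightarrow> (?s a, ?s b) \<in> std_face n N" for a b
    using tie[of a] tie[of b] facesD(1,2)[OF std_face_face[of n N]] permutes_in_image[OF s]
    by blast
  have "(a, b) \<in> act ?s (std_face n N) \<longleftrightarrow> (a, b) \<in> std_face n N" for a b
    unfolding mem_act_inv_iff[OF s] *[of "inv' ?s a" "inv' ?s b"] permutes_inverses[OF s] by (rule refl)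
  then show ?thesis by auto
qed

lemma parabolic_generator:
  assumes "N \<subseteq> simple_roots n" "h \<in> (\<lambda>(i, j). Transposition.transpose i j) ` N"
  shows "\<exists>i. (i, Suc i) \<in> N \<and> h = Transposition.transpose i (Suc i) \<and> h permutes {1..n}"
proof -
  obtain i j where ij: "(i, j) \<in> N" "h = Transposition.transpose i j" using assms(2) by auto
  with assms(1) have "(i, j) \<in> simple_roots n" by blast
  then have j: "j = Suc i" "i \<in> {1..n}" "Suc i \<in> {1..n}" by (auto simp: simple_roots_def)
  from ij permutes_swap_id[OF j(2,3)] show ?thesis unfolding j(1) by blast
qed

lemma parabolic_subgroup:
  assumes N: "N \<subseteq> simple_roots n"
  shows "subgroup (parabolic n N) (sym_group n)"
  unfolding parabolic_def
  by (rule group.generate_is_subgroup[OF sym_group_is_group])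
    (use parabolic_generator[OF N] in \<open>force simp: sym_group_carrier\<close>)

text \<open>Exchanging the values at a descent that lies in \<open>N\<close> increases the sum of \<open>i * v i\<close>. So an
  element of the coset that maximizes this sum has no descent in \<open>N\<close>.\<close>

lemma exists_increasing_in_coset:
  assumes N: "N \<subseteq> simple_roots n" and u: "u permutes {1..n}"
  shows "\<exists>x\<in>parabolic n N. u \<circ> x \<in> X_set n N"
proof -
  interpret P: subgroup "parabolic n N" "sym_group n" by (rule parabolic_subgroup[OF N])
  define S where "S = (\<lambda>x. u \<circ> x) ` parabolic n N"
  define m where "m v = (\<Sum>i\<in>{1..n}. i * v i)" for v :: "nat \<Rightarrow> nat"
  have Sp: "v permutes {1..n}" if "v \<in> S" for v
    using that P.subset u by (auto simp: S_def sym_group_carrier intro!: permutes_compose)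
  then have "finite S" using finite_permutations[of "{1..n}"] by (intro finite_subset[of S]) auto
  moreover have "id \<in> parabolic n N" using P.one_closed by (simp add: sym_group_one)
  then have "S \<noteq> {}" by (auto simp: S_def)
  ultimately have Max: "Max (m ` S) \<in> m ` S" "\<And>x. x \<in> S \<Longrightarrow> m x \<le> Max (m ` S)"
    by simp_all
  then obtain v where v: "v \<in> S" and max: "\<And>x. x \<in> S \<Longrightarrow> m x \<le> m v"
    by (metis imageE)
  have "v k < v (Suc k)" if kN: "(k, Suc k) \<in> N" for k
  proof (rule ccontr)
    assume "\<not> v k < v (Suc k)"
    moreover have "v k \<noteq> v (Suc k)" using permutes_inj[OF Sp[OF v]] by (simp add: inj_eq)
    ultimately have desc: "v (Suc k) < v k" by simp
    let ?s = "Transposition.transpose k (Suc k)"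
    have k: "k \<in> {1..n}" "Suc k \<in> {1..n}" using kN N by (auto simp: simple_roots_def)
    have "?s \<in> parabolic n N"
      unfolding parabolic_def using kN by (intro generate.incl) (auto intro!: image_eqI[of _ _ "(k, Suc k)"])
    moreover obtain x where x: "x \<in> parabolic n N" "v = u \<circ> x" using v by (auto simp: S_def)
    ultimately have "x \<circ> ?s \<in> parabolic n N" using P.m_closed[of x ?s] by (simp add: sym_group_mult)
    then have "v \<circ> ?s \<in> S" using x(2) by (auto simp: S_def comp_assoc)
    then have le: "m (v \<circ> ?s) \<le> m v" by (rule max)
    have split: "m f = k * f k + (Suc k * f (Suc k) + (\<Sum>i\<in>{1..n} - {k} - {Suc k}. i * f i))"
      for f :: "nat \<Rightarrow> nat"
    proof -
      have "m f = k * f k + (\<Sum>i\<in>{1..n} - {k}. i * f i)"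
        unfolding m_def by (rule sum.remove[OF _ k(1)]) simp
      also have "(\<Sum>i\<in>{1..n} - {k}. i * f i)
          = Suc k * f (Suc k) + (\<Sum>i\<in>{1..n} - {k} - {Suc k}. i * f i)"
        using k(2) by (intro sum.remove) auto
      finally show ?thesis .
    qed
    have "(\<Sum>i\<in>{1..n} - {k} - {Suc k}. i * (v \<circ> ?s) i) = (\<Sum>i\<in>{1..n} - {k} - {Suc k}. i * v i)"
      by (intro sum.cong) auto
    then have "k * v (Suc k) + Suc k * v k \<le> k * v k + Suc k * v (Suc k)"
      using le unfolding split by simp
    then show False using desc by simp
  qed
  then have "v \<in> X_set n N" using X_set_iff[OF N] Sp[OF v] by blast
  with v show ?thesis by (auto simp: S_def)
qed

text \<open>A stabilizing permutation can be multiplied by an element of the parabolic subgroup so that it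
  has no descent in \<open>N\<close>. The result still stabilizes the face, and the uniqueness of the decomposition of
  faces forces it to be the identity.\<close>

lemma parabolic_eq_stabilizer:
  assumes N: "N \<subseteq> simple_roots n"
  shows "parabolic n N = {u. u permutes {1..n} \<and> act u (std_face n N) = std_face n N}"
proof (rule equalityI; rule subsetI)
  interpret P: subgroup "parabolic n N" "sym_group n" by (rule parabolic_subgroup[OF N])
  have fixes_std: "act u (std_face n N) = std_face n N \<and> u permutes {1..n}" if "u \<in> parabolic n N" for u
    using that unfolding parabolic_def
  proof (induction rule: generate.induct)
    case one
    then show ?case unfolding sym_group_one by (intro conjI act_id(1) permutes_id)
  next
    case (incl h)
    from parabolic_generator[OF N incl] obtain i where
      i: "(i, Suc i) \<in> N" "h = Transposition.transpose i (Suc i)" "h permutes {1..n}" by blast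
    then show ?case using transpose_fixes_std_face[OF i(1) N] by simp
  next
    case (inv h)
    from parabolic_generator[OF N inv] obtain i where
      i: "(i, Suc i) \<in> N" "h = Transposition.transpose i (Suc i)" and h: "h permutes {1..n}" by blast
    have "act (inv' h) (std_face n N) = std_face n N"
      using act_inv(1)[OF h, of "std_face n N"] transpose_fixes_std_face[OF i(1) N] i(2) by simp
    then show ?case using h permutes_inv[OF h] by (simp add: sym_group_carrier)
  next
    case (eng h1 h2)
    then show ?case using permutes_compose[of h2 "{1..n}" h1] unfolding sym_group_mult act_comp
      by presburger
  qed
  show "u \<in> {u. u permutes {1..n} \<and> act u (std_face n N) = std_face n N}"
    if "u \<in> parabolic n N" for u
    using fixes_std[OF that] by simp
  fix u assume "u \<in> {u. u permutes {1..n} \<and> act u (std_face n N) = std_face n N}"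
  then have u: "u permutes {1..n}" "act u (std_face n N) = std_face n N" by auto
  obtain x where x: "x \<in> parabolic n N" "u \<circ> x \<in> X_set n N"
    using exists_increasing_in_coset[OF N u(1)] by blast
  have "id \<in> X_set n N" unfolding X_set_iff[OF N] using permutes_id by simp
  moreover have "act (u \<circ> x) (std_face n N) = act id (std_face n N)"
    using fixes_std[OF x(1)] u(2) unfolding act_comp act_id by simp
  ultimately have "u \<circ> x = id" using face_decomposition_unique[OF N x(2) N] by blast
  moreover have xp: "x permutes {1..n}" using fixes_std[OF x(1)] by blast
  moreover have "u = (u \<circ> x) \<circ> inv' x" unfolding comp_assoc permutes_inv_o(1)[OF xp] by simp
  ultimately have "u = inv' x" by simp
  moreover have "inv' x \<in> parabolic n N"
    using P.m_inv_closed[OF x(1)] xp by (simp add: sym_group_carrier)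
  ultimately show "u \<in> parabolic n N" by simp
qed

lemma base_subset_std_face: "base_chamber n \<subseteq> std_face n N"
  by (auto simp: base_chamber_def std_face_def)

lemma act_mono: "F \<subseteq> H \<Longrightarrow> act g F \<subseteq> act g H"
  unfolding act_def by (rule image_mono)

lemma std_face_type_unique:
  assumes N: "N \<subseteq> simple_roots n" and M: "M \<subseteq> simple_roots n"
    and u: "u permutes {1..n}" and v: "v permutes {1..n}"
    and eq: "act u (std_face n N) = act v (std_face n M)"
  shows "N = M"
proof -
  obtain x where x: "x \<in> parabolic n N" "u \<circ> x \<in> X_set n N"
    using exists_increasing_in_coset[OF N u] by blast
  obtain y where y: "y \<in> parabolic n M" "v \<circ> y \<in> X_set n M"
    using exists_increasing_in_coset[OF M v] by blast
  have "act (u \<circ> x) (std_face n N) = act (v \<circ> y) (std_face n M)"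
    using x(1) y(1) eq unfolding parabolic_eq_stabilizer[OF N] parabolic_eq_stabilizer[OF M] act_comp
    by simp
  from face_decomposition_unique[OF N x(2) M y(2) this] show ?thesis ..
qed

text \<open>Both sides say that \<open>x\<close> and \<open>w\<close> lie in the same left coset of \<open>S\<^sub>N\<close>.\<close>

lemma chamber_in_face_iff:
  assumes N: "N \<subseteq> simple_roots n" and x: "x permutes {1..n}" and w: "w permutes {1..n}"
  shows "act x (base_chamber n) \<subseteq> act w (std_face n N) \<longleftrightarrow> act x (std_face n N) = act w (std_face n N)"
proof
  assume sub: "act x (base_chamber n) \<subseteq> act w (std_face n N)"
  let ?M = "{(i, Suc i) | i. 1 \<le> i \<and> i < n \<and> (x (Suc i), x i) \<in> act w (std_face n N)}"
  have eq: "act w (std_face n N) = act x (std_face n ?M)"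
    by (rule face_containing_chamber[OF act_faces[OF w std_face_face] x sub])
  have M: "?M \<subseteq> simple_roots n" by (auto simp: simple_roots_def)
  have "N = ?M" by (rule std_face_type_unique[OF N M w x eq])
  then show "act x (std_face n N) = act w (std_face n N)" using eq by presburger
next
  assume "act x (std_face n N) = act w (std_face n N)"
  then show "act x (base_chamber n) \<subseteq> act w (std_face n N)"
    using act_mono[OF base_subset_std_face, of x n N] by simp
qed

lemma act_std_face_mono:
  assumes NM: "N \<subseteq> M" and M: "M \<subseteq> simple_roots n"
    and x: "x permutes {1..n}" and y: "y permutes {1..n}"
    and eq: "act x (std_face n N) = act y (std_face n N)"
  shows "act x (std_face n M) = act y (std_face n M)"
proof -
  have N: "N \<subseteq> simple_roots n" using NM M by blast
  have "act x (base_chamber n) \<subseteq> act y (std_face n N)"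
    using chamber_in_face_iff[OF N x y] eq by simp
  also have "std_face n N \<subseteq> std_face n M" using NM by (auto simp: std_face_def)
  then have "act y (std_face n N) \<subseteq> act y (std_face n M)" by (rule act_mono)
  finally show ?thesis using chamber_in_face_iff[OF M x y] by simp
qed

section \<open>A triangular basis of the functions on the symmetric group\<close>

text \<open>The number of pairs \<open>i \<le> j\<close> minus the number of inversions of \<open>inv' w\<close>, so that large agreement
  means small length.\<close>

definition agreement :: "nat \<Rightarrow> (nat \<Rightarrow> nat) \<Rightarrow> nat" where
  "agreement n w = card (act w (base_chamber n) \<inter> base_chamber n)"

text \<open>The minimal coset representative is strictly shortest in its coset. A pair of the base chamber
  that is allowed by \<open>F\<close> survives in the product of \<open>F\<close> and the base chamber, which gives the inclusion of
  the sets that are counted; and a linear order is determined by this set.\<close>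

lemma agreement_less:
  assumes F: "F \<in> faces n" and w: "w permutes {1..n}" and x: "x permutes {1..n}"
    and Fw: "face_mult F (base_chamber n) = act w (base_chamber n)"
    and sub: "act x (base_chamber n) \<subseteq> F" and ne: "x \<noteq> w"
  shows "agreement n x < agreement n w"
proof -
  let ?B = "base_chamber n"
  have "act x ?B \<inter> ?B \<subseteq> act w ?B \<inter> ?B"
    using sub unfolding Fw[symmetric] face_mult_def by blast
  moreover have "act x ?B \<inter> ?B \<noteq> act w ?B \<inter> ?B"
  proof
    assume eq: "act x ?B \<inter> ?B = act w ?B \<inter> ?B"
    have xf: "act x ?B \<in> faces n" and wf: "act w ?B \<in> faces n"
      by (rule act_faces[OF x base_chamber_face] act_faces[OF w base_chamber_face])+
    have anti: "a = b" if "(a, b) \<in> act v ?B" "(b, a) \<in> act v ?B" "v permutes {1..n}" for a b v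
    proof -
      have "inv' v a = inv' v b"
        using that(1,2) unfolding mem_act_inv_iff[OF that(3)] by (simp add: base_chamber_def)
      then have "v (inv' v a) = v (inv' v b)" by simp
      then show ?thesis unfolding permutes_inverses[OF that(3)] .
    qed
    have agree: "(a, b) \<in> act x ?B \<longleftrightarrow> (a, b) \<in> act w ?B" if "(a, b) \<in> ?B" for a b
      using eq that by blast
    have "(a, b) \<in> act x ?B \<longleftrightarrow> (a, b) \<in> act w ?B" if ab: "a \<in> {1..n}" "b \<in> {1..n}" for a b
    proof (cases "a \<le> b")
      case True
      then show ?thesis using agree[of a b] ab by (simp add: base_chamber_def)
    next
      case False
      then have "(b, a) \<in> act x ?B \<longleftrightarrow> (b, a) \<in> act w ?B"
        using agree[of b a] ab by (simp add: base_chamber_def)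
      moreover have "(a, b) \<in> act v ?B \<longleftrightarrow> (b, a) \<notin> act v ?B"
        if v: "v permutes {1..n}" for v
        using anti[of a b v] v facesD(3)[OF act_faces[OF v base_chamber_face] ab] False by blast
      ultimately show ?thesis using x w by blast
    qed
    then have "act x ?B = act w ?B" using facesD(1)[OF xf] facesD(1)[OF wf] by blast
    then show False using act_base_chamber_inj[OF x w] ne by blast
  qed
  ultimately have "act x ?B \<inter> ?B \<subset> act w ?B \<inter> ?B" by blast
  moreover have "finite ?B"
    by (rule finite_subset[OF facesD(1)[OF base_chamber_face]]) simp
  then have "finite (act w ?B \<inter> ?B)" by blast
  ultimately show ?thesis unfolding agreement_def by (simp add: psubset_card_mono)
qed

definition ascents :: "nat \<Rightarrow> (nat \<Rightarrow> nat) \<Rightarrow> (nat \<times> nat) set" where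
  "ascents n w = simple_roots n - descent_set n w"

lemma ascents_simple: "ascents n w \<subseteq> simple_roots n"
  by (auto simp: ascents_def)

lemma X_set_ascents:
  assumes "N \<subseteq> simple_roots n"
  shows "w \<in> X_set n N \<longleftrightarrow> w permutes {1..n} \<and> N \<subseteq> ascents n w"
  using assms by (auto simp: X_set_def ascents_def sym_group_carrier)

lemma X_setD: "w \<in> X_set n N \<Longrightarrow> w permutes {1..n}"
  by (simp add: X_set_def sym_group_carrier)

text \<open>The indicator function of the largest parabolic left coset in which \<open>w\<close> has minimal length. With
  respect to these functions the spaces of right \<open>S\<^sub>N\<close>-invariant functions are simultaneously spanned
  by basis vectors, for all \<open>N\<close> at once.\<close>

definition cell :: "nat \<Rightarrow> (nat \<Rightarrow> nat) \<Rightarrow> (nat \<Rightarrow> nat) \<Rightarrow> complex" where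
  "cell n w x = (if act x (std_face n (ascents n w)) = act w (std_face n (ascents n w)) then 1 else 0)"

lemma cell_self: "cell n w w = 1"
  by (simp add: cell_def)

lemma cell_triangular:
  assumes w: "w permutes {1..n}" and x: "x permutes {1..n}" and nz: "cell n w x \<noteq> 0" and ne: "x \<noteq> w"
  shows "agreement n x < agreement n w"
proof (rule agreement_less[OF act_faces[OF w std_face_face] w x _ _ ne])
  show "face_mult (act w (std_face n (ascents n w))) (base_chamber n) = act w (base_chamber n)"
    by (rule std_face_chamber[OF ascents_simple]) (use w in \<open>simp add: X_set_ascents[OF ascents_simple]\<close>)
  show "act x (base_chamber n) \<subseteq> act w (std_face n (ascents n w))"
    unfolding chamber_in_face_iff[OF ascents_simple x w]
    using nz by (simp add: cell_def split: if_splits)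
qed

definition coset_invariant :: "nat \<Rightarrow> (nat \<times> nat) set \<Rightarrow> ((nat \<Rightarrow> nat) \<Rightarrow> complex) \<Rightarrow> bool" where
  "coset_invariant n N f \<longleftrightarrow> (\<forall>x y. x permutes {1..n} \<longrightarrow> y permutes {1..n} \<longrightarrow>
     act x (std_face n N) = act y (std_face n N) \<longrightarrow> f x = f y)"

lemma coset_invariantD:
  "coset_invariant n N f \<Longrightarrow> x permutes {1..n} \<Longrightarrow> y permutes {1..n} \<Longrightarrow>
    act x (std_face n N) = act y (std_face n N) \<Longrightarrow> f x = f y"
  unfolding coset_invariant_def by blast

lemma cell_coset_invariant:
  assumes "N \<subseteq> ascents n w"
  shows "coset_invariant n N (cell n w)"
  unfolding coset_invariant_def
proof (intro allI impI)
  fix x y assume "x permutes {1..n}" "y permutes {1..n}" "act x (std_face n N) = act y (std_face n N)"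
  then have "act x (std_face n (ascents n w)) = act y (std_face n (ascents n w))"
    by (rule act_std_face_mono[OF assms ascents_simple])
  then show "cell n w x = cell n w y" by (simp add: cell_def)
qed

abbreviation (input) perms :: "nat \<Rightarrow> (nat \<Rightarrow> nat) set" where
  "perms n \<equiv> {w. w permutes {1..n}}"

lemma finite_perms: "finite {w. w permutes {1..n::nat}}"
  by (rule finite_permutations) simp

lemma exists_increasing_representative:
  assumes N: "N \<subseteq> simple_roots n" and x: "x permutes {1..n}"
  shows "\<exists>y\<in>X_set n N. act y (std_face n N) = act x (std_face n N)"
proof -
  obtain u where u: "u \<in> parabolic n N" "x \<circ> u \<in> X_set n N"
    using exists_increasing_in_coset[OF N x] by blast
  have "act (x \<circ> u) (std_face n N) = act x (std_face n N)"
    using u(1) unfolding parabolic_eq_stabilizer[OF N] act_comp by simp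
  with u(2) show ?thesis by blast
qed

text \<open>Peel off the shortest permutations in the support of \<open>f\<close>. By invariance such a permutation is
  minimal in its coset, so it has no descent in \<open>N\<close> and its cell is again \<open>S\<^sub>N\<close>-invariant; subtracting a
  multiple of this cell removes the permutation from the support and otherwise only changes values at
  longer permutations.\<close>

lemma cells_span_bounded:
  assumes N: "N \<subseteq> simple_roots n" and inv: "coset_invariant n N f"
    and bound: "\<And>x. x permutes {1..n} \<Longrightarrow> f x \<noteq> 0 \<Longrightarrow> agreement n x < k"
  shows "\<exists>c. (\<forall>w. c w \<noteq> 0 \<longrightarrow> w \<in> X_set n N) \<and>
    (\<forall>x\<in>perms n. f x = (\<Sum>w\<in>perms n. c w * cell n w x))"
  using inv bound
proof (induction k arbitrary: f)
  case 0
  then have "\<forall>x\<in>perms n. f x = 0" by blast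
  then show ?case by (intro exI[of _ "\<lambda>_. 0"]) simp
next
  case (Suc k)
  \<comment> \<open>the shortest permutations in the support\<close>
  define A where "A = {x \<in> perms n. agreement n x = k \<and> f x \<noteq> 0}"
  have fin: "finite A" unfolding A_def by (rule finite_subset[OF _ finite_perms]) blast
  have AX: "x \<in> X_set n N" if "x \<in> A" for x
  proof -
    have x: "x permutes {1..n}" "agreement n x = k" "f x \<noteq> 0" using that by (auto simp: A_def)
    obtain y where y: "y \<in> X_set n N" "act y (std_face n N) = act x (std_face n N)"
      using exists_increasing_representative[OF N x(1)] by blast
    note yp = X_setD[OF y(1)]
    have "f y \<noteq> 0" using coset_invariantD[OF Suc.prems(1) yp x(1) y(2)] x(3) by simp
    then have "agreement n y < Suc k" using Suc.prems(2)[OF yp] by blast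
    moreover have "agreement n x < agreement n y" if "x \<noteq> y"
    proof (rule agreement_less[OF act_faces[OF yp std_face_face] yp x(1) std_face_chamber[OF N y(1)] _ that])
      show "act x (base_chamber n) \<subseteq> act y (std_face n N)"
        unfolding chamber_in_face_iff[OF N x(1) yp] using y(2) by simp
    qed
    ultimately show ?thesis using y(1) x(2) by fastforce
  qed
  have Ap: "A \<subseteq> perms n" by (auto simp: A_def)
  define h where "h x = f x - (\<Sum>w\<in>A. f w * cell n w x)" for x
  have "coset_invariant n N h"
    unfolding coset_invariant_def
  proof (intro allI impI)
    fix x y assume xy: "x permutes {1..n}" "y permutes {1..n}" "act x (std_face n N) = act y (std_face n N)"
    have "cell n w x = cell n w y" if "w \<in> A" for w
      using coset_invariantD[OF cell_coset_invariant xy] AX[OF that] X_set_ascents[OF N] by blast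
    then show "h x = h y" using coset_invariantD[OF Suc.prems(1) xy] by (simp add: h_def)
  qed
  moreover have "agreement n x < k" if x: "x permutes {1..n}" and nz: "h x \<noteq> 0" for x
  proof (rule ccontr)
    assume ge: "\<not> agreement n x < k"
    have zero: "cell n w x = 0" if "w \<in> A" "w \<noteq> x" for w
    proof (rule ccontr)
      assume "cell n w x \<noteq> 0"
      then have "agreement n x < agreement n w"
        using cell_triangular[of w n x] that x Ap by blast
      then show False using that ge by (simp add: A_def)
    qed
    show False
    proof (cases "x \<in> A")
      case True
      have "(\<Sum>w\<in>A. f w * cell n w x) = (\<Sum>w\<in>{x}. f w * cell n w x)"
        using True zero fin by (intro sum.mono_neutral_right) auto
      then show False using nz by (simp add: h_def cell_self)
    next
      case False
      have "f x = 0"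
      proof (rule ccontr)
        assume "f x \<noteq> 0"
        with Suc.prems(2)[OF x] ge have "x \<in> A" using x by (simp add: A_def)
        with False show False ..
      qed
      moreover have "(\<Sum>w\<in>A. f w * cell n w x) = 0"
        using zero False by (intro sum.neutral ballI) (metis mult_zero_right)
      ultimately show False using nz by (simp add: h_def)
    qed
  qed
  ultimately obtain c where c: "\<And>w. c w \<noteq> 0 \<Longrightarrow> w \<in> X_set n N"
    "\<And>x. x \<in> perms n \<Longrightarrow> h x = (\<Sum>w\<in>perms n. c w * cell n w x)"
    using Suc.IH[of h] by blast
  define c' where "c' w = c w + (if w \<in> A then f w else 0)" for w
  have "c' w \<noteq> 0 \<longrightarrow> w \<in> X_set n N" for w
    using c(1)[of w] AX[of w] by (auto simp: c'_def)
  moreover have "f x = (\<Sum>w\<in>perms n. c' w * cell n w x)" if "x \<in> perms n" for x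
  proof -
    have "(\<Sum>w\<in>perms n. c' w * cell n w x)
        = h x + (\<Sum>w\<in>perms n. if w \<in> A then f w * cell n w x else 0)"
      unfolding c(2)[OF that] sum.distrib[symmetric] by (intro sum.cong) (auto simp: c'_def ring_distribs)
    also have "(\<Sum>w\<in>perms n. if w \<in> A then f w * cell n w x else 0) = (\<Sum>w\<in>A. f w * cell n w x)"
      unfolding sum.inter_restrict[OF finite_perms, symmetric] Int_absorb1[OF Ap] ..
    finally show ?thesis by (simp add: h_def)
  qed
  ultimately show ?case by blast
qed

lemma cells_span:
  assumes N: "N \<subseteq> simple_roots n" and inv: "coset_invariant n N f"
  shows "\<exists>c. (\<forall>w. c w \<noteq> 0 \<longrightarrow> w \<in> X_set n N) \<and>
    (\<forall>x\<in>perms n. f x = (\<Sum>w\<in>perms n. c w * cell n w x))"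
proof (rule cells_span_bounded[OF N inv])
  fix x assume "x permutes {1..n}"
  show "agreement n x < Suc (card ({1..n} \<times> {1..n}))"
    unfolding agreement_def less_Suc_eq_le
  proof (rule card_mono)
    show "act x (base_chamber n) \<inter> base_chamber n \<subseteq> {1..n} \<times> {1..n}"
      using facesD(1)[OF base_chamber_face[of n]] by blast
  qed simp
qed

text \<open>Evaluate at a shortest permutation with nonzero coefficient.\<close>

lemma cells_independent:
  assumes zero: "\<And>x. x \<in> perms n \<Longrightarrow> (\<Sum>w\<in>perms n. c w * cell n w x) = 0" and w: "w \<in> perms n"
  shows "c w = 0"
proof (rule ccontr)
  assume "c w \<noteq> 0"
  define Z where "Z = {v \<in> perms n. c v \<noteq> 0}"
  have "finite Z" unfolding Z_def by (rule finite_subset[OF _ finite_perms]) blast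
  moreover have "w \<in> Z" using w \<open>c w \<noteq> 0\<close> by (simp add: Z_def)
  ultimately have "Max (agreement n ` Z) \<in> agreement n ` Z"
    and Max: "\<And>x. x \<in> Z \<Longrightarrow> agreement n x \<le> Max (agreement n ` Z)"
    by (auto intro: Max_in)
  then obtain v where v: "v \<in> Z" and Max_eq: "Max (agreement n ` Z) = agreement n v"
    by blast
  note max = Max[unfolded Max_eq]
  have vp: "v permutes {1..n}" "c v \<noteq> 0" using v by (auto simp: Z_def)
  have "c u * cell n u v = 0" if u: "u \<in> perms n - {v}" for u
  proof (rule ccontr)
    assume "c u * cell n u v \<noteq> 0"
    then have nz: "cell n u v \<noteq> 0" "u \<in> Z" using u by (auto simp: Z_def)
    have "agreement n v < agreement n u" using cell_triangular[OF _ vp(1) nz(1)] u by blast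
    then show False using max[OF nz(2)] by simp
  qed
  then have "(\<Sum>u\<in>perms n. c u * cell n u v) = (\<Sum>u\<in>{v}. c u * cell n u v)"
    using vp(1) by (intro sum.mono_neutral_right[OF finite_perms]) auto
  then show False using zero[of v] vp by (simp add: cell_self)
qed

definition coords :: "nat \<Rightarrow> ((nat \<Rightarrow> nat) \<Rightarrow> complex) \<Rightarrow> (nat \<Rightarrow> nat) \<Rightarrow> complex" where
  "coords n f = (SOME c. \<forall>x\<in>perms n. f x = (\<Sum>w\<in>perms n. c w * cell n w x))"

lemma std_face_empty: "std_face n {} = base_chamber n"
  by (auto simp: std_face_def base_chamber_def)

lemma coset_invariant_empty: "coset_invariant n {} f"
  unfolding coset_invariant_def std_face_empty by (intro allI impI arg_cong[of _ _ f] act_base_chamber_inj)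

lemma coords_expansion:
  assumes "x permutes {1..n}"
  shows "f x = (\<Sum>w\<in>perms n. coords n f w * cell n w x)"
proof -
  have "\<exists>c. \<forall>x\<in>perms n. f x = (\<Sum>w\<in>perms n. c w * cell n w x)"
    using cells_span[OF empty_subsetI coset_invariant_empty, of n f] by blast
  then have "\<forall>x\<in>perms n. f x = (\<Sum>w\<in>perms n. coords n f w * cell n w x)"
    unfolding coords_def by (rule someI_ex)
  with assms show ?thesis by blast
qed

lemma coords_unique:
  assumes "\<And>x. x permutes {1..n} \<Longrightarrow> f x = (\<Sum>w\<in>perms n. c w * cell n w x)" and w: "w permutes {1..n}"
  shows "coords n f w = c w"
proof -
  have "coords n f w - c w = 0"
  proof (rule cells_independent[where n = n and w = w and c = "\<lambda>w. coords n f w - c w"])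
    fix x assume "x \<in> perms n"
    then have "f x = (\<Sum>w\<in>perms n. coords n f w * cell n w x)" "f x = (\<Sum>w\<in>perms n. c w * cell n w x)"
      using coords_expansion assms(1) by blast+
    then show "(\<Sum>w\<in>perms n. (coords n f w - c w) * cell n w x) = 0"
      by (simp add: left_diff_distrib sum_subtractf)
  qed (use w in simp)
  then show ?thesis by simp
qed

text \<open>The coordinates supplied by \<open>cells_span\<close> are supported in \<open>X_set n N\<close>, and coordinates are unique.\<close>

lemma coords_vanish:
  assumes N: "N \<subseteq> simple_roots n" and inv: "coset_invariant n N f"
    and w: "w permutes {1..n}" "w \<notin> X_set n N"
  shows "coords n f w = 0"
proof -
  obtain c where c: "\<forall>w. c w \<noteq> 0 \<longrightarrow> w \<in> X_set n N"
    "\<forall>x\<in>perms n. f x = (\<Sum>w\<in>perms n. c w * cell n w x)"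
    using cells_span[OF N inv] by blast
  have "coords n f w = c w" by (rule coords_unique) (use c w in blast)+
  then show ?thesis using c(1) w(2) by metis
qed

section \<open>The left regular representation in the cell basis\<close>

definition cell_rep :: "nat \<Rightarrow> (nat \<Rightarrow> nat) \<Rightarrow> (nat \<Rightarrow> nat) \<Rightarrow> (nat \<Rightarrow> nat) \<Rightarrow> complex" where
  "cell_rep n g u w = coords n (\<lambda>x. cell n w (inv' g \<circ> x)) u"

lemma cell_rep_expansion:
  assumes "x permutes {1..n}"
  shows "cell n w (inv' g \<circ> x) = (\<Sum>u\<in>perms n. cell_rep n g u w * cell n u x)"
  unfolding cell_rep_def by (rule coords_expansion[OF assms])

lemma cell_rep_mult:
  assumes g: "g permutes {1..n}" and h: "h permutes {1..n}" and u: "u permutes {1..n}"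
  shows "cell_rep n (g \<circ> h) u w = (\<Sum>v\<in>perms n. cell_rep n g u v * cell_rep n h v w)"
  unfolding cell_rep_def[of n "g \<circ> h"]
proof (rule coords_unique[OF _ u])
  fix x assume x: "x permutes {1..n}"
  have gx: "inv' g \<circ> x permutes {1..n}" by (rule permutes_compose[OF x permutes_inv[OF g]])
  have "inv' (g \<circ> h) \<circ> x = inv' h \<circ> (inv' g \<circ> x)"
    by (simp only: o_inv_distrib[OF permutes_bij[OF g] permutes_bij[OF h]] comp_assoc)
  then have "cell n w (inv' (g \<circ> h) \<circ> x)
      = (\<Sum>v\<in>perms n. cell_rep n h v w * (\<Sum>u\<in>perms n. cell_rep n g u v * cell n u x))"
    by (simp only: cell_rep_expansion[OF gx, of w h] cell_rep_expansion[OF x, of _ g])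
  also have "\<dots> = (\<Sum>u\<in>perms n. \<Sum>v\<in>perms n. cell_rep n g u v * cell_rep n h v w * cell n u x)"
    unfolding sum_distrib_left by (subst sum.swap) (simp add: mult_ac)
  finally show "cell n w (inv' (g \<circ> h) \<circ> x)
      = (\<Sum>u\<in>perms n. (\<Sum>v\<in>perms n. cell_rep n g u v * cell_rep n h v w) * cell n u x)"
    by (simp only: sum_distrib_right)
qed

lemma coset_invariant_translate:
  assumes g: "g permutes {1..n}" and inv: "coset_invariant n N f"
  shows "coset_invariant n N (\<lambda>x. f (inv' g \<circ> x))"
  unfolding coset_invariant_def
proof (intro allI impI)
  fix x y assume x: "x permutes {1..n}" and y: "y permutes {1..n}"
    and eq: "act x (std_face n N) = act y (std_face n N)"
  have "act (inv' g \<circ> x) (std_face n N) = act (inv' g \<circ> y) (std_face n N)"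
    unfolding act_comp eq ..
  then show "f (inv' g \<circ> x) = f (inv' g \<circ> y)"
    by (rule coset_invariantD[OF inv permutes_compose[OF x permutes_inv[OF g]]
          permutes_compose[OF y permutes_inv[OF g]]])
qed

text \<open>Left translation preserves right \<open>S\<^sub>N\<close>-invariance. With \<open>N = ascents n w\<close>, the translate of the cell
  of \<open>w\<close> therefore only involves cells of permutations whose ascents contain those of \<open>w\<close>.\<close>

lemma cell_rep_triangular:
  assumes g: "g permutes {1..n}" and u: "u permutes {1..n}" and w: "w permutes {1..n}"
    and nz: "cell_rep n g u w \<noteq> 0"
  shows "ascents n w \<subseteq> ascents n u"
proof -
  have "coset_invariant n (ascents n w) (\<lambda>x. cell n w (inv' g \<circ> x))"
    by (rule coset_invariant_translate[OF g cell_coset_invariant]) simp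
  then have "u \<in> X_set n (ascents n w)"
    using coords_vanish[OF ascents_simple _ u] nz unfolding cell_rep_def by blast
  then show ?thesis by (simp add: X_set_ascents[OF ascents_simple])
qed

text \<open>The cells of \<open>X_set n N\<close> and the indicators \<open>E y\<close> of the cosets of \<open>S\<^sub>N\<close> are two bases of the
  right \<open>S\<^sub>N\<close>-invariant functions. In the second basis left translation is the permutation of the cosets,
  that is, of the faces of type \<open>N\<close>, and its trace counts the fixed ones.\<close>

lemma cell_rep_trace:
  assumes N: "N \<subseteq> simple_roots n" and g: "g permutes {1..n}"
  shows "(\<Sum>w\<in>X_set n N. cell_rep n g w w)
    = of_nat (card {v \<in> X_set n N. act g (act v (std_face n N)) = act v (std_face n N)})"
proof -
  define E where "E y x = (if act x (std_face n N) = act y (std_face n N) then 1 else 0 :: complex)" for y x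
  have E_inv: "coset_invariant n N (E y)" for y
    unfolding coset_invariant_def by (simp add: E_def)
  have fX: "finite (X_set n N)" using X_setD by (intro finite_subset[OF _ finite_perms]) blast
  \<comment> \<open>expansion of an invariant function in the coset indicators\<close>
  have pick: "(\<Sum>y\<in>X_set n N. f y * E y x) = f x"
    if f: "coset_invariant n N f" and x: "x permutes {1..n}" for f x
  proof -
    obtain z where z: "z \<in> X_set n N" "act z (std_face n N) = act x (std_face n N)"
      using exists_increasing_representative[OF N x] by blast
    have "E y x = (if y = z then 1 else 0)" if "y \<in> X_set n N" for y
    proof -
      have "act x (std_face n N) = act y (std_face n N) \<longleftrightarrow> y = z"
        unfolding z(2)[symmetric] using face_decomposition_unique[OF N that N z(1)] by blast
      then show ?thesis by (simp only: E_def)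
    qed
    then have "(\<Sum>y\<in>X_set n N. f y * E y x) = (\<Sum>y\<in>X_set n N. if y = z then f y else 0)"
      by (intro sum.cong refl) simp
    also have "\<dots> = f z" using fX z(1) by simp
    also have "\<dots> = f x" by (rule coset_invariantD[OF f X_setD[OF z(1)] x z(2)])
    finally show ?thesis .
  qed
  \<comment> \<open>pass to the coset basis, permute the cosets, and return to the cells\<close>
  have rep: "cell_rep n g u w = (\<Sum>y\<in>X_set n N. cell n w y * coords n (E (g \<circ> y)) u)"
    if w: "w \<in> X_set n N" and u: "u permutes {1..n}" for u w
    unfolding cell_rep_def
  proof (rule coords_unique[OF _ u])
    fix x assume x: "x permutes {1..n}"
    have gx: "inv' g \<circ> x permutes {1..n}" by (rule permutes_compose[OF x permutes_inv[OF g]])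
    have shift: "E y (inv' g \<circ> x) = E (g \<circ> y) x" for y
    proof -
      have "act (inv' g \<circ> x) (std_face n N) = act y (std_face n N) \<longleftrightarrow>
          act g (act (inv' g) (act x (std_face n N))) = act g (act y (std_face n N))"
        unfolding act_comp act_eq_iff[OF g] ..
      then show ?thesis unfolding E_def act_comp act_inv(2)[OF g] by simp
    qed
    have "coset_invariant n N (cell n w)"
      using w X_set_ascents[OF N] by (intro cell_coset_invariant) blast
    then have "cell n w (inv' g \<circ> x) = (\<Sum>y\<in>X_set n N. cell n w y * E (g \<circ> y) x)"
      using pick[OF _ gx, of "cell n w"] unfolding shift by simp
    also have "\<dots> = (\<Sum>y\<in>X_set n N. cell n w y * (\<Sum>u\<in>perms n. coords n (E (g \<circ> y)) u * cell n u x))"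
      using coords_expansion[OF x] by (intro sum.cong refl arg_cong2[where f = "(*)"]) blast
    also have "\<dots> = (\<Sum>u\<in>perms n. \<Sum>y\<in>X_set n N. cell n w y * coords n (E (g \<circ> y)) u * cell n u x)"
      unfolding sum_distrib_left by (subst sum.swap) (simp add: mult_ac)
    finally show "cell n w (inv' g \<circ> x)
        = (\<Sum>u\<in>perms n. (\<Sum>y\<in>X_set n N. cell n w y * coords n (E (g \<circ> y)) u) * cell n u x)"
      by (simp only: sum_distrib_right)
  qed
  have "(\<Sum>w\<in>X_set n N. cell_rep n g w w)
      = (\<Sum>w\<in>X_set n N. \<Sum>y\<in>X_set n N. coords n (E (g \<circ> y)) w * cell n w y)"
    using rep[OF _ X_setD] by (intro sum.cong refl) (simp only: mult.commute)
  also have "\<dots> = (\<Sum>y\<in>X_set n N. \<Sum>w\<in>X_set n N. coords n (E (g \<circ> y)) w * cell n w y)"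
    by (rule sum.swap)
  also have "\<dots> = (\<Sum>y\<in>X_set n N. if act g (act y (std_face n N)) = act y (std_face n N) then 1 else 0)"
  proof (rule sum.cong[OF refl])
    fix y assume y: "y \<in> X_set n N"
    have "(\<Sum>w\<in>X_set n N. coords n (E (g \<circ> y)) w * cell n w y)
        = (\<Sum>w\<in>perms n. coords n (E (g \<circ> y)) w * cell n w y)"
      using coords_vanish[OF N E_inv] X_setD
      by (intro sum.mono_neutral_left[OF finite_perms]) auto
    also have "\<dots> = E (g \<circ> y) y" by (rule coords_expansion[OF X_setD[OF y], symmetric])
    finally show "(\<Sum>w\<in>X_set n N. coords n (E (g \<circ> y)) w * cell n w y)
        = (if act g (act y (std_face n N)) = act y (std_face n N) then 1 else 0)"
      unfolding E_def act_comp eq_commute[of "act y (std_face n N)"] .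
  qed
  also have "\<dots> = of_nat (card {y \<in> X_set n N. act g (act y (std_face n N)) = act y (std_face n N)})"
    by (simp add: sum.If_cases[OF fX] Int_def)
  finally show ?thesis .
qed


section \<open>Descent classes carry representations\<close>

definition block :: "nat \<Rightarrow> (nat \<times> nat) set \<Rightarrow> (nat \<Rightarrow> nat) set" where
  "block n A = {w. w permutes {1..n} \<and> ascents n w = A}"

lemma finite_block: "finite (block n A)"
  unfolding block_def by (rule finite_subset[OF _ finite_perms]) blast

text \<open>Triangularity confines the sum over intermediate permutations to those whose ascents lie
  between \<open>A\<close> and \<open>A\<close>. Hence the diagonal blocks of the triangular matrices are themselves representations,
  one for each descent class, of degree equal to the size of the class.\<close>

lemma cell_rep_block_mult:
  assumes g: "g permutes {1..n}" and h: "h permutes {1..n}" and u: "u \<in> block n A" and w: "w \<in> block n A"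
  shows "cell_rep n (g \<circ> h) u w = (\<Sum>v\<in>block n A. cell_rep n g u v * cell_rep n h v w)"
proof -
  have uw: "u permutes {1..n}" "w permutes {1..n}" "ascents n u = A" "ascents n w = A"
    using u w by (simp_all add: block_def)
  have "cell_rep n g u v * cell_rep n h v w = 0" if v: "v \<in> perms n - block n A" for v
  proof (rule ccontr)
    assume "cell_rep n g u v * cell_rep n h v w \<noteq> 0"
    then have nz: "cell_rep n g u v \<noteq> 0" "cell_rep n h v w \<noteq> 0" by auto
    have vp: "v permutes {1..n}" using v by blast
    have "ascents n v \<subseteq> A" using cell_rep_triangular[OF g uw(1) vp nz(1)] uw(3) by simp
    moreover have "A \<subseteq> ascents n v" using cell_rep_triangular[OF h vp uw(2) nz(2)] uw(4) by simp
    ultimately show False using v vp by (simp add: block_def)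
  qed
  moreover have "block n A \<subseteq> perms n" by (auto simp: block_def)
  ultimately show ?thesis unfolding cell_rep_mult[OF g h uw(1)]
    by (intro sum.mono_neutral_right[OF finite_perms]) blast+
qed

lemma block_multiplicities_le:
  assumes "finite (Irr (sym_group n))"
  shows "(\<Sum>V\<in>Irr (sym_group n). cmod (of_nat (irr_dim V) / of_nat (card (carrier (sym_group n))) *
     (\<Sum>g\<in>carrier (sym_group n). irr_char V (inv\<^bsub>sym_group n\<^esub> g) * (\<Sum>w\<in>block n A. cell_rep n g w w))))
     \<le> real (card (block n A))"
proof -
  define m where "m = card (block n A)"
  obtain e where e: "bij_betw e {..<m} (block n A)"
    using ex_bij_betw_nat_finite[OF finite_block] unfolding m_def lessThan_atLeast0 by blast
  have eb: "e i \<in> block n A" if "i < m" for i using e that by (auto simp: bij_betw_def)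
  define R where "R g = mat m m (\<lambda>(i, j). cell_rep n g (e i) (e j))" for g
  have R: "R g \<in> carrier_mat m m" for g by (simp add: R_def)
  have mult: "R (g \<otimes>\<^bsub>sym_group n\<^esub> h) = R g * R h"
    if "g \<in> carrier (sym_group n)" "h \<in> carrier (sym_group n)" for g h
  proof (rule eq_matI)
    fix i j assume "i < dim_row (R g * R h)" "j < dim_col (R g * R h)"
    then have ij: "i < m" "j < m" by (simp_all add: R_def)
    have "R (g \<otimes>\<^bsub>sym_group n\<^esub> h) $$ (i, j) = cell_rep n (g \<circ> h) (e i) (e j)"
      using ij by (simp add: R_def sym_group_mult)
    also have "\<dots> = (\<Sum>v\<in>block n A. cell_rep n g (e i) v * cell_rep n h v (e j))"
      using that eb ij by (intro cell_rep_block_mult) (simp_all only: sym_group_carrier)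
    also have "\<dots> = (\<Sum>a<m. cell_rep n g (e i) (e a) * cell_rep n h (e a) (e j))"
      by (rule sum.reindex_bij_betw[OF e, symmetric])
    also have "\<dots> = (R g * R h) $$ (i, j)"
      unfolding mult_mat_entry[OF R R ij] using ij by (intro sum.cong refl) (simp add: R_def)
    finally show "R (g \<otimes>\<^bsub>sym_group n\<^esub> h) $$ (i, j) = (R g * R h) $$ (i, j)" .
  qed (simp_all add: R_def)
  have trace: "mat_trace (R g) = (\<Sum>w\<in>block n A. cell_rep n g w w)" for g
    using sum.reindex_bij_betw[OF e, of "\<lambda>w. cell_rep n g w w"] by (simp add: mat_trace_def R_def)
  have fin: "finite (carrier (sym_group n))"
    using finite_perms[of n] by (simp add: sym_group_def)
  show ?thesis
    using group.sum_multiplicities_le_degree[OF sym_group_is_group R mult fin] unfolding trace m_def .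
qed

section \<open>Weights on faces\<close>

definition invariant_weight :: "nat \<Rightarrow> ((nat \<times> nat) set \<Rightarrow> real) \<Rightarrow> bool" where
  "invariant_weight n \<mu> \<longleftrightarrow> (\<forall>g F. g permutes {1..n} \<longrightarrow> F \<in> faces n \<longrightarrow> \<mu> (act g F) = \<mu> F)"

text \<open>This is a class function if the weight is invariant. For the indicator of the faces of type \<open>N\<close>
  it is the character induced from the trivial character of \<open>S\<^sub>N\<close>.\<close>

definition fixed_weight :: "nat \<Rightarrow> ((nat \<times> nat) set \<Rightarrow> real) \<Rightarrow> (nat \<Rightarrow> nat) \<Rightarrow> real" where
  "fixed_weight n \<mu> g = (\<Sum>F\<in>faces n. if act g F = F then \<mu> F else 0)"

text \<open>The image of the weight under multiplication by the base chamber. For the indicator of the faces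
  of type \<open>N\<close> it is the indicator of \<open>X_set n N\<close>.\<close>

definition chamber_weight :: "nat \<Rightarrow> ((nat \<times> nat) set \<Rightarrow> real) \<Rightarrow> (nat \<Rightarrow> nat) \<Rightarrow> real" where
  "chamber_weight n \<mu> w =
     (\<Sum>F\<in>faces n. if face_mult F (base_chamber n) = act w (base_chamber n) then \<mu> F else 0)"

lemma invariant_weightD:
  "invariant_weight n \<mu> \<Longrightarrow> g permutes {1..n} \<Longrightarrow> F \<in> faces n \<Longrightarrow> \<mu> (act g F) = \<mu> F"
  by (simp only: invariant_weight_def)

lemma finite_simple_roots: "finite (simple_roots n)"
  by (rule finite_subset[of _ "{1..n} \<times> {1..n}"]) (auto simp: simple_roots_def)

lemma finite_X_set: "finite (X_set n N)"
  using X_setD by (intro finite_subset[OF _ finite_perms]) blast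

lemma sum_faces:
  fixes f :: "(nat \<times> nat) set \<Rightarrow> real"
  shows "(\<Sum>F\<in>faces n. f F) = (\<Sum>N\<in>Pow (simple_roots n). \<Sum>w\<in>X_set n N. f (act w (std_face n N)))"
proof -
  let ?D = "SIGMA N:Pow (simple_roots n). X_set n N"
  let ?h = "\<lambda>(N, w). act w (std_face n N)"
  have "bij_betw ?h ?D (faces n)"
    unfolding bij_betw_def
  proof
    show "inj_on ?h ?D"
    proof (rule inj_onI, clarify)
      fix N w M v assume "N \<subseteq> simple_roots n" "w \<in> X_set n N" "M \<subseteq> simple_roots n" "v \<in> X_set n M"
        "act w (std_face n N) = act v (std_face n M)"
      from face_decomposition_unique[OF this] show "N = M \<and> w = v" by blast
    qed
    show "?h ` ?D = faces n"
    proof (rule equalityI; rule subsetI)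
      fix F assume "F \<in> ?h ` ?D"
      then obtain N w where F: "F = act w (std_face n N)" "w \<in> X_set n N" by auto
      show "F \<in> faces n" unfolding F(1) by (rule act_faces[OF X_setD[OF F(2)] std_face_face])
    next
      fix F assume "F \<in> faces n"
      from face_decomposition[OF this] obtain N w where
        "N \<subseteq> simple_roots n" "w \<in> X_set n N" "F = act w (std_face n N)" by blast
      then show "F \<in> ?h ` ?D" by (intro image_eqI[of _ _ "(N, w)"]) auto
    qed
  qed
  then have "(\<Sum>F\<in>faces n. f F) = (\<Sum>x\<in>?D. f (?h x))"
    by (rule sum.reindex_bij_betw[symmetric])
  also have "\<dots> = (\<Sum>(N, w)\<in>?D. f (act w (std_face n N)))"
    by (intro sum.cong refl) auto
  also have "\<dots> = (\<Sum>N\<in>Pow (simple_roots n). \<Sum>w\<in>X_set n N. f (act w (std_face n N)))"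
    using finite_simple_roots finite_X_set by (intro sum.Sigma[symmetric]) auto
  finally show ?thesis .
qed

lemma chamber_weight_eq:
  assumes inv: "invariant_weight n \<mu>" and w: "w permutes {1..n}"
  shows "chamber_weight n \<mu> w = (\<Sum>N\<in>Pow (simple_roots n). \<mu> (std_face n N) * indicator (X_set n N) w)"
  unfolding chamber_weight_def sum_faces
proof (rule sum.cong[OF refl])
  fix N assume "N \<in> Pow (simple_roots n)"
  then have N: "N \<subseteq> simple_roots n" by blast
  have "(\<Sum>v\<in>X_set n N. if face_mult (act v (std_face n N)) (base_chamber n) = act w (base_chamber n)
          then \<mu> (act v (std_face n N)) else 0)
      = (\<Sum>v\<in>X_set n N. if v = w then \<mu> (std_face n N) else 0)"
  proof (rule sum.cong[OF refl])
    fix v assume v: "v \<in> X_set n N"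
    have "face_mult (act v (std_face n N)) (base_chamber n) = act w (base_chamber n) \<longleftrightarrow> v = w"
      unfolding std_face_chamber[OF N v] using act_base_chamber_inj[OF X_setD[OF v] w] by blast
    then show "(if face_mult (act v (std_face n N)) (base_chamber n) = act w (base_chamber n)
          then \<mu> (act v (std_face n N)) else 0) = (if v = w then \<mu> (std_face n N) else 0)"
      using invariant_weightD[OF inv X_setD[OF v] std_face_face] by (simp only: if_cancel)
  qed
  also have "\<dots> = \<mu> (std_face n N) * indicator (X_set n N) w"
    using finite_X_set by (simp add: indicator_def)
  finally show "(\<Sum>v\<in>X_set n N. if face_mult (act v (std_face n N)) (base_chamber n) = act w (base_chamber n)
          then \<mu> (act v (std_face n N)) else 0) = \<mu> (std_face n N) * indicator (X_set n N) w" .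
qed

lemma fixed_weight_eq:
  assumes inv: "invariant_weight n \<mu>"
  shows "fixed_weight n \<mu> g = (\<Sum>N\<in>Pow (simple_roots n). \<mu> (std_face n N) *
     card {v \<in> X_set n N. act g (act v (std_face n N)) = act v (std_face n N)})"
  unfolding fixed_weight_def sum_faces
proof (rule sum.cong[OF refl])
  fix N
  have "(\<Sum>v\<in>X_set n N. if act g (act v (std_face n N)) = act v (std_face n N)
          then \<mu> (act v (std_face n N)) else 0)
      = (\<Sum>v\<in>X_set n N. if act g (act v (std_face n N)) = act v (std_face n N) then \<mu> (std_face n N) else 0)"
  proof (rule sum.cong[OF refl])
    fix v assume v: "v \<in> X_set n N"
    show "(if act g (act v (std_face n N)) = act v (std_face n N)
          then \<mu> (act v (std_face n N)) else 0)
      = (if act g (act v (std_face n N)) = act v (std_face n N) then \<mu> (std_face n N) else 0)"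
      unfolding invariant_weightD[OF inv X_setD[OF v] std_face_face] ..
  qed
  also have "\<dots> = \<mu> (std_face n N) * card {v \<in> X_set n N. act g (act v (std_face n N)) = act v (std_face n N)}"
    by (simp add: sum.If_cases[OF finite_X_set] Int_def)
  finally show "(\<Sum>v\<in>X_set n N. if act g (act v (std_face n N)) = act v (std_face n N)
          then \<mu> (act v (std_face n N)) else 0)
      = \<mu> (std_face n N) * card {v \<in> X_set n N. act g (act v (std_face n N)) = act v (std_face n N)}" .
qed

text \<open>Both sides are linear in the weight; for the faces of type \<open>N\<close> this is \<open>cell_rep_trace\<close>.\<close>

lemma fixed_weight_chamber_weight:
  assumes inv: "invariant_weight n \<mu>" and g: "g permutes {1..n}"
  shows "complex_of_real (fixed_weight n \<mu> g)
    = (\<Sum>w\<in>perms n. complex_of_real (chamber_weight n \<mu> w) * cell_rep n g w w)"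
proof -
  have "complex_of_real (fixed_weight n \<mu> g)
      = (\<Sum>N\<in>Pow (simple_roots n). \<mu> (std_face n N) * (\<Sum>w\<in>X_set n N. cell_rep n g w w))"
    unfolding fixed_weight_eq[OF inv] of_real_sum of_real_mult of_real_of_nat_eq
    by (intro sum.cong refl arg_cong2[where f = "(*)"] cell_rep_trace[OF _ g, symmetric]) blast
  also have "\<dots> = (\<Sum>N\<in>Pow (simple_roots n). \<Sum>w\<in>perms n.
      complex_of_real (\<mu> (std_face n N) * indicator (X_set n N) w) * cell_rep n g w w)"
  proof (rule sum.cong[OF refl])
    fix N
    have "(\<Sum>w\<in>perms n. complex_of_real (\<mu> (std_face n N) * indicator (X_set n N) w) * cell_rep n g w w)
        = (\<Sum>w\<in>X_set n N. complex_of_real (\<mu> (std_face n N) * indicator (X_set n N) w) * cell_rep n g w w)"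
      using X_setD by (intro sum.mono_neutral_right[OF finite_perms]) (blast, simp)
    also have "\<dots> = \<mu> (std_face n N) * (\<Sum>w\<in>X_set n N. cell_rep n g w w)"
      unfolding sum_distrib_left by (intro sum.cong refl) simp
    finally show "\<mu> (std_face n N) * (\<Sum>w\<in>X_set n N. cell_rep n g w w) = (\<Sum>w\<in>perms n.
      complex_of_real (\<mu> (std_face n N) * indicator (X_set n N) w) * cell_rep n g w w)" by (rule sym)
  qed
  also have "\<dots> = (\<Sum>w\<in>perms n. complex_of_real (chamber_weight n \<mu> w) * cell_rep n g w w)"
    by (subst sum.swap, rule sum.cong[OF refl])
      (simp only: mem_Collect_eq chamber_weight_eq[OF inv] of_real_sum sum_distrib_right)
  finally show ?thesis .
qed

text \<open>The chamber weight is constant on descent classes, with value \<open>q A\<close> on the permutations with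
  ascents \<open>A\<close>. So the class function on the left is the combination with coefficients \<open>q A\<close> of the
  characters of the representations carried by the descent classes. The multiplicities in each of them,
  weighted by dimensions, add up to at most the size of the class, and the triangle inequality does the
  rest.\<close>

theorem multiplicities_le_chamber_weight:
  assumes inv: "invariant_weight n \<mu>"
  shows "(\<Sum>V\<in>Irr (sym_group n). cmod (of_nat (irr_dim V) / of_nat (card (carrier (sym_group n))) *
     (\<Sum>g\<in>carrier (sym_group n). irr_char V (inv\<^bsub>sym_group n\<^esub> g) * complex_of_real (fixed_weight n \<mu> g))))
     \<le> (\<Sum>w\<in>perms n. \<bar>chamber_weight n \<mu> w\<bar>)"
proof (cases "finite (Irr (sym_group n))")
  case False
  then show ?thesis by (simp add: sum_nonneg)
next
  case fin: True
  let ?G = "sym_group n"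
  let ?S = "Pow (simple_roots n)"
  define q where "q A = (\<Sum>N\<in>Pow (simple_roots n). if N \<subseteq> A then \<mu> (std_face n N) else 0)" for A
  have cw: "chamber_weight n \<mu> w = q (ascents n w)" if w: "w permutes {1..n}" for w
    unfolding chamber_weight_eq[OF inv w] q_def
    by (intro sum.cong refl) (use w in \<open>simp add: X_set_ascents indicator_def\<close>)
  have split: "(\<Sum>w\<in>perms n. f w) = (\<Sum>A\<in>?S. \<Sum>w\<in>block n A. f w)" for f :: "_ \<Rightarrow> 'b :: comm_monoid_add"
  proof -
    have "(\<Sum>A\<in>?S. sum f {w. w \<in> perms n \<and> ascents n w = A}) = sum f (perms n)"
      by (rule sum.group[OF finite_perms]) (use finite_simple_roots ascents_simple in auto)
    then show ?thesis by (simp add: block_def)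
  qed
  define m where "m V A = cmod (of_nat (irr_dim V) / of_nat (card (carrier ?G)) *
     (\<Sum>g\<in>carrier ?G. irr_char V (inv\<^bsub>?G\<^esub> g) * (\<Sum>w\<in>block n A. cell_rep n g w w)))" for V A
  have V_le: "cmod (of_nat (irr_dim V) / of_nat (card (carrier ?G)) *
     (\<Sum>g\<in>carrier ?G. irr_char V (inv\<^bsub>?G\<^esub> g) * complex_of_real (fixed_weight n \<mu> g)))
     \<le> (\<Sum>A\<in>?S. \<bar>q A\<bar> * m V A)" for V
  proof -
    let ?c = "of_nat (irr_dim V) / of_nat (card (carrier ?G)) :: complex"
    have fw: "complex_of_real (fixed_weight n \<mu> g)
        = (\<Sum>A\<in>?S. q A * (\<Sum>w\<in>block n A. cell_rep n g w w))" if "g \<in> carrier ?G" for g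
    proof -
      have g: "g permutes {1..n}" using that by (simp only: sym_group_carrier)
      have "(\<Sum>w\<in>block n A. complex_of_real (chamber_weight n \<mu> w) * cell_rep n g w w)
          = q A * (\<Sum>w\<in>block n A. cell_rep n g w w)" for A
        unfolding sum_distrib_left by (intro sum.cong refl) (simp add: block_def cw)
      then show ?thesis unfolding fixed_weight_chamber_weight[OF inv g] split by simp
    qed
    have "?c * (\<Sum>g\<in>carrier ?G. irr_char V (inv\<^bsub>?G\<^esub> g) * complex_of_real (fixed_weight n \<mu> g))
        = ?c * (\<Sum>g\<in>carrier ?G. \<Sum>A\<in>?S. q A * (irr_char V (inv\<^bsub>?G\<^esub> g) * (\<Sum>w\<in>block n A. cell_rep n g w w)))"
      by (intro arg_cong2[where f = "(*)"] refl sum.cong)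
        (simp only: fw sum_distrib_left mult.left_commute)
    also have "\<dots> = (\<Sum>A\<in>?S. q A * (?c * (\<Sum>g\<in>carrier ?G. irr_char V (inv\<^bsub>?G\<^esub> g) * (\<Sum>w\<in>block n A. cell_rep n g w w))))"
      by (subst sum.swap) (simp only: sum_distrib_left mult.left_commute)
    also have "cmod \<dots> \<le> (\<Sum>A\<in>?S. \<bar>q A\<bar> * m V A)"
      unfolding m_def by (rule order_trans[OF norm_sum]) (simp only: norm_mult norm_of_real order_refl)
    finally show ?thesis .
  qed
  have "(\<Sum>V\<in>Irr ?G. cmod (of_nat (irr_dim V) / of_nat (card (carrier ?G)) *
     (\<Sum>g\<in>carrier ?G. irr_char V (inv\<^bsub>?G\<^esub> g) * complex_of_real (fixed_weight n \<mu> g))))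
     \<le> (\<Sum>V\<in>Irr ?G. \<Sum>A\<in>?S. \<bar>q A\<bar> * m V A)"
    by (rule sum_mono) (rule V_le)
  also have "\<dots> = (\<Sum>A\<in>?S. \<bar>q A\<bar> * (\<Sum>V\<in>Irr ?G. m V A))"
    by (subst sum.swap) (simp only: sum_distrib_left)
  also have "\<dots> \<le> (\<Sum>A\<in>?S. \<bar>q A\<bar> * real (card (block n A)))"
    unfolding m_def by (intro sum_mono mult_left_mono block_multiplicities_le[OF fin]) simp
  also have "\<dots> = (\<Sum>A\<in>?S. \<Sum>w\<in>block n A. \<bar>chamber_weight n \<mu> w\<bar>)"
  proof (rule sum.cong[OF refl])
    fix A
    have "(\<Sum>w\<in>block n A. \<bar>chamber_weight n \<mu> w\<bar>) = (\<Sum>w\<in>block n A. \<bar>q A\<bar>)"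
      by (intro sum.cong refl) (simp add: block_def cw)
    then show "\<bar>q A\<bar> * real (card (block n A)) = (\<Sum>w\<in>block n A. \<bar>chamber_weight n \<mu> w\<bar>)" by simp
  qed
  also have "\<dots> = (\<Sum>w\<in>perms n. \<bar>chamber_weight n \<mu> w\<bar>)" by (rule split[symmetric])
  finally show ?thesis .
qed

section \<open>Convolution of weights\<close>

definition face_conv :: "nat \<Rightarrow> ((nat \<times> nat) set \<Rightarrow> real) \<Rightarrow> ((nat \<times> nat) set \<Rightarrow> real) \<Rightarrow>
    (nat \<times> nat) set \<Rightarrow> real" where
  "face_conv n \<mu> \<nu> F = (\<Sum>G\<in>faces n. \<Sum>H\<in>faces n. if face_mult G H = F then \<mu> G * \<nu> H else 0)"

lemma sum_face_conv:
  "(\<Sum>F\<in>faces n. if P F then face_conv n \<mu> \<nu> F else 0)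
    = (\<Sum>H\<in>faces n. \<nu> H * (\<Sum>G\<in>faces n. if P (face_mult G H) then \<mu> G else 0))"
proof -
  have "(\<Sum>F\<in>faces n. if P F then face_conv n \<mu> \<nu> F else 0)
      = (\<Sum>F\<in>faces n. \<Sum>G\<in>faces n. \<Sum>H\<in>faces n. if F = face_mult G H then if P F then \<mu> G * \<nu> H else 0 else 0)"
  proof (rule sum.cong[OF refl])
    fix F
    show "(if P F then face_conv n \<mu> \<nu> F else 0)
        = (\<Sum>G\<in>faces n. \<Sum>H\<in>faces n. if F = face_mult G H then if P F then \<mu> G * \<nu> H else 0 else 0)"
    proof (cases "P F")
      case True
      show ?thesis unfolding face_conv_def if_P[OF True] eq_commute[of F] ..
    next
      case False
      show ?thesis unfolding if_not_P[OF False] if_cancel by simp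
    qed
  qed
  also have "\<dots> = (\<Sum>G\<in>faces n. \<Sum>H\<in>faces n. \<Sum>F\<in>faces n. if F = face_mult G H then if P F then \<mu> G * \<nu> H else 0 else 0)"
    by (subst sum.swap, rule sum.cong[OF refl], subst sum.swap, rule refl)
  also have "\<dots> = (\<Sum>G\<in>faces n. \<Sum>H\<in>faces n. if P (face_mult G H) then \<mu> G * \<nu> H else 0)"
    by (intro sum.cong refl) (simp add: finite_faces face_mult_faces)
  also have "\<dots> = (\<Sum>H\<in>faces n. \<nu> H * (\<Sum>G\<in>faces n. if P (face_mult G H) then \<mu> G else 0))"
    by (subst sum.swap) (auto simp: sum_distrib_left intro!: sum.cong)
  finally show ?thesis .
qed

text \<open>A product of two faces is fixed exactly when both factors are.\<close>

lemma fixed_weight_conv: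
  assumes g: "g permutes {1..n}"
  shows "fixed_weight n (face_conv n \<mu> \<nu>) g = fixed_weight n \<mu> g * fixed_weight n \<nu> g"
proof -
  have "fixed_weight n (face_conv n \<mu> \<nu>) g
      = (\<Sum>H\<in>faces n. \<nu> H * (\<Sum>G\<in>faces n. if act g (face_mult G H) = face_mult G H then \<mu> G else 0))"
    unfolding fixed_weight_def by (rule sum_face_conv)
  also have "\<dots> = (\<Sum>H\<in>faces n. (if act g H = H then \<nu> H else 0) * fixed_weight n \<mu> g)"
  proof (rule sum.cong[OF refl])
    fix H assume H: "H \<in> faces n"
    have "(\<Sum>G\<in>faces n. if act g (face_mult G H) = face_mult G H then \<mu> G else 0)
        = (\<Sum>G\<in>faces n. if act g H = H then if act g G = G then \<mu> G else 0 else 0)"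
      by (intro sum.cong refl) (simp only: act_face_mult_fixed_iff[OF g _ H], simp)
    then show "\<nu> H * (\<Sum>G\<in>faces n. if act g (face_mult G H) = face_mult G H then \<mu> G else 0)
        = (if act g H = H then \<nu> H else 0) * fixed_weight n \<mu> g"
      by (simp add: fixed_weight_def)
  qed
  also have "\<dots> = fixed_weight n \<mu> g * fixed_weight n \<nu> g"
    unfolding fixed_weight_def[of n \<nu>] sum_distrib_right[symmetric] by (rule mult.commute)
  finally show ?thesis .
qed

lemma sum_faces_act:
  assumes g: "g permutes {1..n}"
  shows "(\<Sum>F\<in>faces n. f (act g F)) = (\<Sum>F\<in>faces n. f F)"
  by (rule sum.reindex_bij_witness[of _ "act (inv' g)" "act g"])
    (simp_all only: act_inv[OF g] act_faces[OF g] act_faces[OF permutes_inv[OF g]])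

lemma invariant_weight_conv:
  assumes \<mu>: "invariant_weight n \<mu>" and \<nu>: "invariant_weight n \<nu>"
  shows "invariant_weight n (face_conv n \<mu> \<nu>)"
  unfolding invariant_weight_def
proof (intro allI impI)
  fix g F assume g: "g permutes {1..n}" and F: "F \<in> faces n"
  have "face_conv n \<mu> \<nu> (act g F)
      = (\<Sum>G\<in>faces n. \<Sum>H\<in>faces n. if face_mult (act g G) (act g H) = act g F then \<mu> (act g G) * \<nu> (act g H) else 0)"
    unfolding face_conv_def
    using sum_faces_act[OF g, of "\<lambda>G. \<Sum>H\<in>faces n. if face_mult G H = act g F then \<mu> G * \<nu> H else 0"]
      sum_faces_act[OF g, of "\<lambda>H. if face_mult (act g G) H = act g F then \<mu> (act g G) * \<nu> H else 0" for G]
    by presburger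
  also have "\<dots> = face_conv n \<mu> \<nu> F"
    unfolding face_conv_def act_face_mult[OF g, symmetric] act_eq_iff[OF g]
    by (intro sum.cong refl) (simp only: invariant_weightD[OF \<mu> g] invariant_weightD[OF \<nu> g])
  finally show "face_conv n \<mu> \<nu> (act g F) = face_conv n \<mu> \<nu> F" .
qed

lemma chamber_of_face:
  assumes H: "H \<in> faces n"
  shows "\<exists>!a. a \<in> perms n \<and> face_mult H (base_chamber n) = act a (base_chamber n)"
proof -
  obtain N w where N: "N \<subseteq> simple_roots n" and w: "w \<in> X_set n N" and Hw: "H = act w (std_face n N)"
    using face_decomposition[OF H] by blast
  have eq: "face_mult H (base_chamber n) = act w (base_chamber n)"
    unfolding Hw by (rule std_face_chamber[OF N w])
  show ?thesis
  proof (rule ex1I[of _ w])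
    show "w \<in> perms n \<and> face_mult H (base_chamber n) = act w (base_chamber n)"
      using eq X_setD[OF w] by blast
    fix a assume "a \<in> perms n \<and> face_mult H (base_chamber n) = act a (base_chamber n)"
    then have "a permutes {1..n}" "act a (base_chamber n) = act w (base_chamber n)"
      unfolding eq by (blast, metis)
    then show "a = w" using act_base_chamber_inj X_setD[OF w] by blast
  qed
qed

text \<open>Write the product of \<open>H\<close> and the base chamber as the chamber of \<open>a\<close>. A face \<open>G\<close> moves the chamber of
  \<open>a\<close> to that of \<open>w\<close> exactly when the translate of \<open>G\<close> by \<open>inv' a\<close> moves the base chamber to that of
  \<open>inv' a \<circ> w\<close>, and the translate has the same weight. So the right factor of the convolution of weights becomes
  the left factor in the group algebra.\<close>

lemma chamber_weight_conv:
  assumes \<mu>: "invariant_weight n \<mu>" and w: "w permutes {1..n}"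
  shows "chamber_weight n (face_conv n \<mu> \<nu>) w
    = (\<Sum>a\<in>perms n. chamber_weight n \<nu> a * chamber_weight n \<mu> (inv' a \<circ> w))"
proof -
  let ?C = "base_chamber n"
  have inner: "(\<Sum>G\<in>faces n. if face_mult G (act a ?C) = act w ?C then \<mu> G else 0)
      = chamber_weight n \<mu> (inv' a \<circ> w)" if a: "a permutes {1..n}" for a
  proof -
    have "(\<Sum>G\<in>faces n. if face_mult G (act a ?C) = act w ?C then \<mu> G else 0)
        = (\<Sum>G\<in>faces n. if face_mult (act a G) (act a ?C) = act w ?C then \<mu> (act a G) else 0)"
      by (rule sum_faces_act[OF a, symmetric])
    also have "\<dots> = chamber_weight n \<mu> (inv' a \<circ> w)"
      unfolding chamber_weight_def
    proof (rule sum.cong[OF refl])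
      fix G assume G: "G \<in> faces n"
      have "face_mult (act a G) (act a ?C) = act w ?C \<longleftrightarrow>
          act a (face_mult G ?C) = act a (act (inv' a) (act w ?C))"
        unfolding act_face_mult[OF a] act_inv(2)[OF a] ..
      also have "\<dots> \<longleftrightarrow> face_mult G ?C = act (inv' a \<circ> w) ?C"
        unfolding act_eq_iff[OF a] act_comp ..
      finally show "(if face_mult (act a G) (act a ?C) = act w ?C then \<mu> (act a G) else 0)
          = (if face_mult G ?C = act (inv' a \<circ> w) ?C then \<mu> G else 0)"
        by (simp only: invariant_weightD[OF \<mu> a G])
    qed
    finally show ?thesis .
  qed
  have "chamber_weight n (face_conv n \<mu> \<nu>) w
      = (\<Sum>H\<in>faces n. \<nu> H * (\<Sum>G\<in>faces n. if face_mult G (face_mult H ?C) = act w ?C then \<mu> G else 0))"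
    unfolding chamber_weight_def sum_face_conv[where P = "\<lambda>F. face_mult F ?C = act w ?C"] face_mult_assoc ..
  also have "\<dots> = (\<Sum>H\<in>faces n. \<Sum>a\<in>perms n.
      if face_mult H ?C = act a ?C then \<nu> H * chamber_weight n \<mu> (inv' a \<circ> w) else 0)"
  proof (rule sum.cong[OF refl])
    fix H assume "H \<in> faces n"
    from chamber_of_face[OF this] obtain b where b: "b permutes {1..n}" "face_mult H ?C = act b ?C"
      and uniq: "\<And>a. a permutes {1..n} \<Longrightarrow> face_mult H ?C = act a ?C \<Longrightarrow> a = b" by blast
    have "(\<Sum>a\<in>perms n. if face_mult H ?C = act a ?C then \<nu> H * chamber_weight n \<mu> (inv' a \<circ> w) else 0)
        = (\<Sum>a\<in>perms n. if a = b then \<nu> H * chamber_weight n \<mu> (inv' a \<circ> w) else 0)"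
    proof (rule sum.cong[OF refl])
      fix a assume "a \<in> perms n"
      then have "face_mult H ?C = act a ?C \<longleftrightarrow> a = b" using uniq b(2) by blast
      then show "(if face_mult H ?C = act a ?C then \<nu> H * chamber_weight n \<mu> (inv' a \<circ> w) else 0)
          = (if a = b then \<nu> H * chamber_weight n \<mu> (inv' a \<circ> w) else 0)" by (simp only:)
    qed
    also have "\<dots> = \<nu> H * chamber_weight n \<mu> (inv' b \<circ> w)"
      using b(1) by (subst sum.delta[OF finite_perms]) simp
    finally show "\<nu> H * (\<Sum>G\<in>faces n. if face_mult G (face_mult H ?C) = act w ?C then \<mu> G else 0)
        = (\<Sum>a\<in>perms n. if face_mult H ?C = act a ?C then \<nu> H * chamber_weight n \<mu> (inv' a \<circ> w) else 0)"
      unfolding b(2) inner[OF b(1)] by (simp only:)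
  qed
  also have "\<dots> = (\<Sum>a\<in>perms n. chamber_weight n \<nu> a * chamber_weight n \<mu> (inv' a \<circ> w))"
    unfolding chamber_weight_def[of n \<nu>]
    by (subst sum.swap) (simp add: sum_distrib_right if_distrib[of "\<lambda>x. x * _"] cong: if_cong)
  finally show ?thesis .
qed

lemma group_algebra_mult_sym_group:
  assumes w: "w permutes {1..n}"
  shows "(f \<otimes>\<^bsub>group_algebra (sym_group n)\<^esub> h) w = (\<Sum>a\<in>perms n. f a * h (inv' a \<circ> w))"
proof -
  let ?D = "{(a, b) \<in> carrier (sym_group n) \<times> carrier (sym_group n). a \<otimes>\<^bsub>sym_group n\<^esub> b = w}"
  have "(\<Sum>(a, b)\<in>?D. f a * h b) = (\<Sum>a\<in>perms n. f a * h (inv' a \<circ> w))"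
  proof (rule sum.reindex_bij_witness[of _ "\<lambda>a. (a, inv' a \<circ> w)" fst])
    fix x assume "x \<in> ?D"
    then obtain a b where x: "x = (a, b)" and a: "a permutes {1..n}" and ab: "a \<circ> b = w"
      by (auto simp: sym_group_carrier sym_group_mult)
    have b: "b = inv' a \<circ> w"
      unfolding ab[symmetric] comp_assoc[symmetric] permutes_inv_o(2)[OF a] by simp
    show "(fst x, inv' (fst x) \<circ> w) = x" "fst x \<in> perms n"
      "f (fst x) * h (inv' (fst x) \<circ> w) = (case x of (a, b) \<Rightarrow> f a * h b)"
      unfolding x b using a by simp_all
  next
    fix a assume "a \<in> perms n"
    then have a: "a permutes {1..n}" by blast
    have "inv' a \<circ> w permutes {1..n}" by (rule permutes_compose[OF w permutes_inv[OF a]])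
    moreover have "a \<circ> (inv' a \<circ> w) = w"
      unfolding comp_assoc[symmetric] permutes_inv_o(1)[OF a] by simp
    ultimately show "(a, inv' a \<circ> w) \<in> ?D"
      using a unfolding mem_Collect_eq prod.case mem_Times_iff fst_conv snd_conv sym_group_carrier sym_group_mult
      by blast
  qed simp_all
  then show ?thesis by (simp add: group_algebra_def)
qed

text \<open>Powers for \<open>face_conv\<close>. The neutral element is the point mass at the face with a single block, in
  which all elements are tied.\<close>

fun face_power :: "nat \<Rightarrow> ((nat \<times> nat) set \<Rightarrow> real) \<Rightarrow> nat \<Rightarrow> (nat \<times> nat) set \<Rightarrow> real" where
  "face_power n \<mu> 0 = indicator {{1..n} \<times> {1..n}}"
| "face_power n \<mu> (Suc r) = face_conv n \<mu> (face_power n \<mu> r)"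

lemma trivial_face: "{1..n} \<times> {1..n} \<in> faces n"
  by (rule facesI) auto

lemma act_trivial_face:
  assumes "g permutes {1..n}"
  shows "act g F = {1..n} \<times> {1..n} \<longleftrightarrow> F = {1..n} \<times> {1..n}"
proof -
  have "act g ({1..n} \<times> {1..n}) = {1..n} \<times> {1..n}"
    unfolding act_def map_prod_surj_on[OF permutes_image[OF assms] permutes_image[OF assms]] ..
  then show ?thesis using act_eq_iff[OF assms, of F "{1..n} \<times> {1..n}"] by simp
qed

lemma invariant_face_power:
  assumes "invariant_weight n \<mu>"
  shows "invariant_weight n (face_power n \<mu> r)"
proof (induction r)
  case 0
  show ?case unfolding invariant_weight_def
  proof (intro allI impI)
    fix g F assume "g permutes {1..n}"
    from act_trivial_face[OF this, of F] show "face_power n \<mu> 0 (act g F) = face_power n \<mu> 0 F"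
      by (simp add: indicator_def)
  qed
qed (simp add: invariant_weight_conv assms)

lemma fixed_weight_face_power:
  assumes g: "g permutes {1..n}"
  shows "fixed_weight n (face_power n \<mu> r) g = fixed_weight n \<mu> g ^ r"
proof (induction r)
  case 0
  have "fixed_weight n (face_power n \<mu> 0) g = (\<Sum>F\<in>faces n. if F = {1..n} \<times> {1..n} then 1 else 0)"
    unfolding fixed_weight_def
    by (intro sum.cong refl) (use act_trivial_face[OF g] in \<open>auto simp: indicator_def\<close>)
  also have "\<dots> = 1" using finite_faces trivial_face by simp
  finally show ?case by simp
qed (simp add: fixed_weight_conv[OF g])

lemma chamber_weight_face_power:
  assumes \<mu>: "invariant_weight n \<mu>" and Q: "\<And>w. w permutes {1..n} \<Longrightarrow> Q w = chamber_weight n \<mu> w"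
    and w: "w permutes {1..n}"
  shows "chamber_weight n (face_power n \<mu> r) w = (Q [^]\<^bsub>group_algebra (sym_group n)\<^esub> r) w"
  using w
proof (induction r arbitrary: w)
  case 0
  have "face_mult ({1..n} \<times> {1..n}) (base_chamber n) = act id (base_chamber n)"
    unfolding act_id by (auto simp: face_mult_def base_chamber_def)
  then have "face_mult ({1..n} \<times> {1..n}) (base_chamber n) = act w (base_chamber n) \<longleftrightarrow> w = id"
    using act_base_chamber_inj[OF 0 permutes_id] by metis
  then have "chamber_weight n (face_power n \<mu> 0) w
      = (\<Sum>F\<in>faces n. if F = {1..n} \<times> {1..n} then indicator {id} w else 0)"
    unfolding chamber_weight_def by (intro sum.cong refl) (auto simp: indicator_def)
  also have "\<dots> = indicator {id} w" using finite_faces trivial_face by simp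
  finally show ?case by (simp add: nat_pow_def group_algebra_def sym_group_one)
next
  case (Suc r)
  let ?A = "group_algebra (sym_group n)"
  have "(Q [^]\<^bsub>?A\<^esub> Suc r) w = ((Q [^]\<^bsub>?A\<^esub> r) \<otimes>\<^bsub>?A\<^esub> Q) w" by (simp add: nat_pow_def)
  also have "\<dots> = (\<Sum>a\<in>perms n. (Q [^]\<^bsub>?A\<^esub> r) a * Q (inv' a \<circ> w))"
    by (rule group_algebra_mult_sym_group[OF Suc.prems])
  also have "\<dots> = (\<Sum>a\<in>perms n. chamber_weight n (face_power n \<mu> r) a * chamber_weight n \<mu> (inv' a \<circ> w))"
  proof (rule sum.cong[OF refl])
    fix a assume "a \<in> perms n"
    then have a: "a permutes {1..n}" by blast
    show "(Q [^]\<^bsub>?A\<^esub> r) a * Q (inv' a \<circ> w)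
        = chamber_weight n (face_power n \<mu> r) a * chamber_weight n \<mu> (inv' a \<circ> w)"
      unfolding Suc.IH[OF a] Q[OF permutes_compose[OF Suc.prems permutes_inv[OF a]]] ..
  qed
  also have "\<dots> = chamber_weight n (face_power n \<mu> (Suc r)) w"
    unfolding face_power.simps by (rule chamber_weight_conv[OF \<mu> Suc.prems, symmetric])
  finally show ?case ..
qed

text \<open>The weight that takes the value \<open>a N\<close> on all faces of type \<open>N\<close>; every face has a type, and by
  \<open>std_face_type_unique\<close> only one.\<close>

definition type_weight :: "nat \<Rightarrow> ((nat \<times> nat) set \<Rightarrow> real) \<Rightarrow> (nat \<times> nat) set \<Rightarrow> real" where
  "type_weight n a F = a (THE N. N \<subseteq> simple_roots n \<and> (\<exists>w. w permutes {1..n} \<and> F = act w (std_face n N)))"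

lemma type_weight_act_std_face:
  assumes N: "N \<subseteq> simple_roots n" and w: "w permutes {1..n}"
  shows "type_weight n a (act w (std_face n N)) = a N"
proof -
  have "(THE M. M \<subseteq> simple_roots n \<and> (\<exists>v. v permutes {1..n} \<and> act w (std_face n N) = act v (std_face n M))) = N"
  proof (rule the_equality)
    show "N \<subseteq> simple_roots n \<and> (\<exists>v. v permutes {1..n} \<and> act w (std_face n N) = act v (std_face n N))"
      using N w by blast
    fix M assume "M \<subseteq> simple_roots n \<and> (\<exists>v. v permutes {1..n} \<and> act w (std_face n N) = act v (std_face n M))"
    then show "M = N" using std_face_type_unique[OF N _ w] by blast
  qed
  then show ?thesis unfolding type_weight_def by (rule arg_cong)
qed

lemma type_weight_std_face:
  "N \<subseteq> simple_roots n \<Longrightarrow> type_weight n a (std_face n N) = a N"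
  using type_weight_act_std_face[OF _ permutes_id, of N n a] unfolding act_id by blast

lemma invariant_type_weight: "invariant_weight n (type_weight n a)"
  unfolding invariant_weight_def
proof (intro allI impI)
  fix g F assume g: "g permutes {1..n}" and "F \<in> faces n"
  from face_decomposition[OF this(2)] obtain N w where
    N: "N \<subseteq> simple_roots n" and w: "w \<in> X_set n N" and F: "F = act w (std_face n N)" by blast
  show "type_weight n a (act g F) = type_weight n a F"
    unfolding F act_comp[symmetric] type_weight_act_std_face[OF N permutes_compose[OF X_setD[OF w] g]]
      type_weight_act_std_face[OF N X_setD[OF w]] ..
qed

lemma chamber_weight_type_weight:
  assumes "w permutes {1..n}"
  shows "chamber_weight n (type_weight n a) w = (\<Sum>N\<in>Pow (simple_roots n). a N * indicator (X_set n N) w)"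
  unfolding chamber_weight_eq[OF invariant_type_weight assms]
  by (intro sum.cong refl) (simp only: type_weight_std_face Pow_iff)

lemma fixed_weight_type_weight:
  "fixed_weight n (type_weight n a) g = (\<Sum>N\<in>Pow (simple_roots n). a N *
     card {v \<in> X_set n N. act g (act v (std_face n N)) = act v (std_face n N)})"
  unfolding fixed_weight_eq[OF invariant_type_weight]
  by (intro sum.cong refl) (simp only: type_weight_std_face Pow_iff)

text \<open>A permutation \<open>x\<close> contributes to the induced character exactly when \<open>g\<close> fixes the face
  \<open>act x (std_face n N)\<close>. Each face of type \<open>N\<close> arises from \<open>card (parabolic n N)\<close> permutations, which cancels
  the normalizing factor.\<close>

lemma induced_char_parabolic:
  assumes N: "N \<subseteq> simple_roots n" and g: "g permutes {1..n}"
  shows "induced_char (sym_group n) (parabolic n N) (\<lambda>_. 1) g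
    = of_nat (card {v \<in> X_set n N. act g (act v (std_face n N)) = act v (std_face n N)})"
proof -
  let ?F = "std_face n N" and ?G = "sym_group n"
  define P where "P x = (if act g (act x ?F) = act x ?F then 1 else 0 :: complex)" for x
  have carr: "carrier ?G = perms n" by (simp add: sym_group_def)
  have "(\<Sum>x\<in>carrier ?G. let y = inv\<^bsub>?G\<^esub> x \<otimes>\<^bsub>?G\<^esub> g \<otimes>\<^bsub>?G\<^esub> x in if y \<in> parabolic n N then 1 else 0 :: complex)
      = (\<Sum>x\<in>perms n. P x)"
    unfolding carr
  proof (rule sum.cong[OF refl])
    fix x assume "x \<in> perms n"
    then have x: "x permutes {1..n}" by blast
    have "inv\<^bsub>?G\<^esub> x \<otimes>\<^bsub>?G\<^esub> g \<otimes>\<^bsub>?G\<^esub> x = inv' x \<circ> g \<circ> x"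
      using x by (simp only: sym_group_inv_equality sym_group_carrier sym_group_mult)
    moreover have "inv' x \<circ> g \<circ> x \<in> parabolic n N \<longleftrightarrow> act g (act x ?F) = act x ?F"
    proof -
      have "inv' x \<circ> g \<circ> x permutes {1..n}"
        by (intro permutes_compose x g permutes_inv)
      moreover have "act (inv' x \<circ> g \<circ> x) ?F = ?F \<longleftrightarrow> act x (act (inv' x) (act g (act x ?F))) = act x ?F"
        unfolding act_eq_iff[OF x] act_comp ..
      ultimately show ?thesis
        unfolding parabolic_eq_stabilizer[OF N] act_inv(2)[OF x] by blast
    qed
    ultimately show "(let y = inv\<^bsub>?G\<^esub> x \<otimes>\<^bsub>?G\<^esub> g \<otimes>\<^bsub>?G\<^esub> x in if y \<in> parabolic n N then 1 else 0) = P x"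
      by (simp only: Let_def P_def)
  qed
  also have "\<dots> = (\<Sum>v\<in>X_set n N. \<Sum>x\<in>{x \<in> perms n. act x ?F = act v ?F}. P x)"
  proof -
    have inj: "inj_on (\<lambda>v. act v ?F) (X_set n N)"
      by (rule inj_onI) (use face_decomposition_unique[OF N _ N] in blast)
    have "(\<Sum>x\<in>perms n. P x) = (\<Sum>y\<in>(\<lambda>v. act v ?F) ` X_set n N. \<Sum>x\<in>{x \<in> perms n. act x ?F = y}. P x)"
    proof (rule sum.group[symmetric])
      show "(\<lambda>x. act x ?F) ` perms n \<subseteq> (\<lambda>v. act v ?F) ` X_set n N"
      proof (rule subsetI)
        fix y assume "y \<in> (\<lambda>x. act x ?F) ` perms n"
        then obtain x where x: "x permutes {1..n}" "y = act x ?F" by blast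
        from exists_increasing_representative[OF N x(1)] x(2) show "y \<in> (\<lambda>v. act v ?F) ` X_set n N"
          by (metis image_eqI)
      qed
    qed (use finite_perms finite_X_set in blast)+
    also have "\<dots> = (\<Sum>v\<in>X_set n N. \<Sum>x\<in>{x \<in> perms n. act x ?F = act v ?F}. P x)"
      using sum.reindex[OF inj] by simp
    finally show ?thesis .
  qed
  also have "\<dots> = (\<Sum>v\<in>X_set n N. of_nat (card (parabolic n N)) * P v)"
  proof (rule sum.cong[OF refl])
    fix v assume v: "v \<in> X_set n N"
    note vp = X_setD[OF v]
    have "bij_betw (\<lambda>u. v \<circ> u) (parabolic n N) {x \<in> perms n. act x ?F = act v ?F}"
    proof (rule bij_betwI[of _ _ _ "\<lambda>x. inv' v \<circ> x"])
      show "(\<lambda>u. v \<circ> u) \<in> parabolic n N \<rightarrow> {x \<in> perms n. act x ?F = act v ?F}"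
      proof (rule funcsetI)
        fix u assume "u \<in> parabolic n N"
        then have u: "u permutes {1..n}" "act u ?F = ?F" unfolding parabolic_eq_stabilizer[OF N] by blast+
        have "act (v \<circ> u) ?F = act v ?F" unfolding act_comp u(2) ..
        with permutes_compose[OF u(1) vp] show "v \<circ> u \<in> {x \<in> perms n. act x ?F = act v ?F}" by blast
      qed
      show "(\<lambda>x. inv' v \<circ> x) \<in> {x \<in> perms n. act x ?F = act v ?F} \<rightarrow> parabolic n N"
      proof (rule funcsetI)
        fix x assume "x \<in> {x \<in> perms n. act x ?F = act v ?F}"
        then have x: "x permutes {1..n}" "act x ?F = act v ?F" by blast+
        have "act (inv' v \<circ> x) ?F = ?F" unfolding act_comp x(2) by (rule act_inv(1)[OF vp])
        then show "inv' v \<circ> x \<in> parabolic n N"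
          unfolding parabolic_eq_stabilizer[OF N] using permutes_compose[OF x(1) permutes_inv[OF vp]] by blast
      qed
      show "inv' v \<circ> (v \<circ> u) = u" for u
        unfolding comp_assoc[symmetric] permutes_inv_o(2)[OF vp] by simp
      show "v \<circ> (inv' v \<circ> x) = x" for x
        unfolding comp_assoc[symmetric] permutes_inv_o(1)[OF vp] by simp
    qed
    then have "card (parabolic n N) = card {x \<in> perms n. act x ?F = act v ?F}"
      by (rule bij_betw_same_card)
    moreover have "P x = P v" if "act x ?F = act v ?F" for x unfolding P_def that ..
    then have "(\<Sum>x\<in>{x \<in> perms n. act x ?F = act v ?F}. P x) = (\<Sum>x\<in>{x \<in> perms n. act x ?F = act v ?F}. P v)"
      by (intro sum.cong refl) blast
    ultimately show "(\<Sum>x\<in>{x \<in> perms n. act x ?F = act v ?F}. P x) = of_nat (card (parabolic n N)) * P v"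
      by simp
  qed
  also have "\<dots> = of_nat (card (parabolic n N)) *
      of_nat (card {v \<in> X_set n N. act g (act v ?F) = act v ?F})"
    unfolding sum_distrib_left[symmetric] P_def by (simp add: sum.If_cases[OF finite_X_set] Int_def)
  finally have "induced_char ?G (parabolic n N) (\<lambda>_. 1) g = 1 / of_nat (card (parabolic n N)) *
      (of_nat (card (parabolic n N)) * of_nat (card {v \<in> X_set n N. act g (act v ?F) = act v ?F}))"
    unfolding induced_char_def by (simp only:)
  moreover have "card (parabolic n N) \<noteq> 0"
  proof -
    interpret S: subgroup "parabolic n N" ?G by (rule parabolic_subgroup[OF N])
    have "parabolic n N \<subseteq> perms n" using S.subset carr by blast
    then have "finite (parabolic n N)" using finite_perms finite_subset by blast
    moreover have "parabolic n N \<noteq> {}" using S.one_closed by blast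
    ultimately show ?thesis by simp
  qed
  ultimately show ?thesis by simp
qed

section \<open>The bound by total variation distance\<close>

theorem corollary3p2:
  fixes n r :: nat and p :: "(nat \<times> nat) set \<Rightarrow> real"
  assumes "n > 0" and "r > 0"
    and "\<And>L. L \<subseteq> simple_roots n \<Longrightarrow> p L \<ge> 0"
    and "(\<Sum>L\<in>Pow (simple_roots n). p L) = 1"
  shows "1 / 2 * (\<Sum>V\<in>Irr (sym_group n).
            cmod (of_nat (irr_dim V) *
                  char_inner (sym_group n) (irr_char V)
                    (\<lambda>g. (\<Sum>L\<in>Pow (simple_roots n).
                            complex_of_real (p L * real (card (parabolic n L)) / fact n) *
                            induced_char (sym_group n) (parabolic n L) (\<lambda>_. 1) g) ^ r)
                  - complex_of_real (plancherel (sym_group n) V)))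
         \<le> total_variation (carrier (sym_group n))
             ((\<lambda>g. \<Sum>L\<in>Pow (simple_roots n).
                      p L * real (card (parabolic n L)) / fact n * indicator (X_set n L) g)
                [^]\<^bsub>group_algebra (sym_group n)\<^esub> r)
             (\<lambda>_. 1 / fact n)"
proof -
  let ?G = "sym_group n"
  interpret G: group ?G by (rule sym_group_is_group)
  have carr: "carrier ?G = perms n" by (simp add: sym_group_def)
  have card: "card (carrier ?G) = fact n"
    unfolding carr using card_permutations[of "{1..n}" n] by simp
  \<comment> \<open>\<open>\<mu>\<close> has chamber weight \<open>Q\<close>, the measure of the walk, and fixed weight \<open>\<phi>\<close>, the combination of induced characters\<close>
  define a where "a L = p L * real (card (parabolic n L)) / fact n" for L
  define \<mu> where "\<mu> = type_weight n a"
  define Q where "Q g = (\<Sum>L\<in>Pow (simple_roots n). a L * indicator (X_set n L) g)" for g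
  \<comment> \<open>the uniform weight on linear orders: its chamber weight is the uniform distribution, and
    its fixed weight, the normalized regular character, produces the Plancherel measure\<close>
  define unif where "unif = type_weight n (\<lambda>N. if N = {} then 1 / fact n else 0)"
  define \<nu> where "\<nu> F = face_power n \<mu> r F - unif F" for F
  have inv_\<mu>: "invariant_weight n \<mu>" unfolding \<mu>_def by (rule invariant_type_weight)
  have inv_\<nu>: "invariant_weight n \<nu>"
    using invariant_face_power[OF inv_\<mu>, of r] invariant_type_weight
    unfolding \<nu>_def unif_def invariant_weight_def by presburger
  have chamber_unif: "chamber_weight n unif w = 1 / fact n" if w: "w permutes {1..n}" for w
  proof -
    have "chamber_weight n unif w = (\<Sum>N\<in>Pow (simple_roots n). if N = {} then 1 / fact n else 0)"
      unfolding unif_def chamber_weight_type_weight[OF w]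
      by (intro sum.cong refl) (use w in \<open>auto simp: X_set_iff\<close>)
    then show ?thesis using finite_simple_roots by simp
  qed
  have fixed_unif: "fixed_weight n unif g = (if g = id then 1 else 0)" if g: "g permutes {1..n}" for g
  proof -
    have X: "X_set n {} = perms n" by (auto simp: X_set_iff)
    have "fixed_weight n unif g = (\<Sum>N\<in>Pow (simple_roots n). if N = {} then
        card {v \<in> perms n. act g (act v (base_chamber n)) = act v (base_chamber n)} / fact n else 0)"
      unfolding unif_def fixed_weight_type_weight
      by (intro sum.cong refl) (simp add: std_face_empty X)
    also have "\<dots> = card {v \<in> perms n. act g (act v (base_chamber n)) = act v (base_chamber n)} / fact n"
      using finite_simple_roots by simp
    also have "{v \<in> perms n. act g (act v (base_chamber n)) = act v (base_chamber n)}
        = (if g = id then perms n else {})"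
    proof -
      have "act g (act v (base_chamber n)) = act v (base_chamber n) \<longleftrightarrow> g = id" if v: "v permutes {1..n}" for v
      proof
        assume "act g (act v (base_chamber n)) = act v (base_chamber n)"
        then have "act (g \<circ> v) (base_chamber n) = act v (base_chamber n)" unfolding act_comp .
        then have gv: "g \<circ> v = v" by (rule act_base_chamber_inj[OF permutes_compose[OF v g] v])
        have "g = g \<circ> v \<circ> inv' v" unfolding comp_assoc permutes_inv_o(1)[OF v] by simp
        also have "\<dots> = id" unfolding gv by (rule permutes_inv_o(1)[OF v])
        finally show "g = id" .
      qed (simp only: act_id)
      then show ?thesis by auto
    qed
    finally show ?thesis using card carr by simp
  qed
  have chamber_\<nu>: "chamber_weight n \<nu> w = (Q [^]\<^bsub>group_algebra ?G\<^esub> r) w - 1 / fact n"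
    if w: "w permutes {1..n}" for w
  proof -
    have "chamber_weight n \<nu> w = chamber_weight n (face_power n \<mu> r) w - chamber_weight n unif w"
      unfolding chamber_weight_def \<nu>_def sum_subtractf[symmetric] by (intro sum.cong refl) simp
    also have "chamber_weight n (face_power n \<mu> r) w = (Q [^]\<^bsub>group_algebra ?G\<^esub> r) w"
      by (rule chamber_weight_face_power[OF inv_\<mu> _ w])
        (simp only: Q_def \<mu>_def chamber_weight_type_weight)
    finally show ?thesis unfolding chamber_unif[OF w] .
  qed
  define \<phi> where "\<phi> g = (\<Sum>L\<in>Pow (simple_roots n). complex_of_real (a L) *
      induced_char ?G (parabolic n L) (\<lambda>_. 1) g)" for g
  have fixed_\<nu>: "complex_of_real (fixed_weight n \<nu> g) = \<phi> g ^ r - (if g = id then 1 else 0)"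
    if g: "g permutes {1..n}" for g
  proof -
    have "fixed_weight n \<nu> g = fixed_weight n (face_power n \<mu> r) g - fixed_weight n unif g"
      unfolding fixed_weight_def \<nu>_def sum_subtractf[symmetric] by (intro sum.cong refl) simp
    also have "\<dots> = fixed_weight n \<mu> g ^ r - (if g = id then 1 else 0)"
      unfolding fixed_unif[OF g] fixed_weight_face_power[OF g] ..
    moreover have "complex_of_real (fixed_weight n \<mu> g) = \<phi> g"
      unfolding \<mu>_def fixed_weight_type_weight \<phi>_def of_real_sum
      by (intro sum.cong refl) (simp add: induced_char_parabolic[OF _ g])
    ultimately show ?thesis by simp
  qed
  have fixed_inv: "fixed_weight n \<nu> (inv' g) = fixed_weight n \<nu> g" if g: "g permutes {1..n}" for g
  proof -
    have "act (inv' g) F = F \<longleftrightarrow> act g F = F" for F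
      using act_inv[OF g, of F] by metis
    then show ?thesis by (simp only: fixed_weight_def)
  qed
  \<comment> \<open>complex conjugation moves from the character to the outside, as the class function is real
    and takes the same value at \<open>g\<close> and at its inverse\<close>
  have summand_eq: "cmod (of_nat (irr_dim V) * char_inner ?G (irr_char V) (\<lambda>g. \<phi> g ^ r)
        - complex_of_real (plancherel ?G V))
      = cmod (of_nat (irr_dim V) / of_nat (card (carrier ?G)) *
          (\<Sum>g\<in>carrier ?G. irr_char V (inv\<^bsub>?G\<^esub> g) * complex_of_real (fixed_weight n \<nu> g)))"
    if V: "V \<in> Irr ?G" for V
  proof -
    let ?d = "of_nat (irr_dim V) :: complex" and ?N = "of_nat (card (carrier ?G)) :: complex"
    let ?X = "?d / ?N * (\<Sum>g\<in>carrier ?G. irr_char V (inv\<^bsub>?G\<^esub> g) * complex_of_real (fixed_weight n \<nu> g))"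
    let ?Y = "?d * char_inner ?G (irr_char V) (\<lambda>g. \<phi> g ^ r) - complex_of_real (plancherel ?G V)"
    have one: "\<one>\<^bsub>?G\<^esub> = id" by (rule sym_group_one)
    have "(\<Sum>g\<in>carrier ?G. irr_char V (inv\<^bsub>?G\<^esub> g) * complex_of_real (fixed_weight n \<nu> g))
        = (\<Sum>g\<in>carrier ?G. irr_char V (inv\<^bsub>?G\<^esub> g) * complex_of_real (fixed_weight n \<nu> (inv\<^bsub>?G\<^esub> g)))"
    proof (rule sum.cong[OF refl])
      fix g assume g: "g \<in> carrier ?G"
      show "irr_char V (inv\<^bsub>?G\<^esub> g) * complex_of_real (fixed_weight n \<nu> g)
          = irr_char V (inv\<^bsub>?G\<^esub> g) * complex_of_real (fixed_weight n \<nu> (inv\<^bsub>?G\<^esub> g))"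
        using fixed_inv g unfolding sym_group_inv_equality[OF g] sym_group_carrier by presburger
    qed
    also have "\<dots> = (\<Sum>g\<in>carrier ?G. irr_char V g * complex_of_real (fixed_weight n \<nu> g))"
      by (rule G.sum_inverse)
    finally have "cnj (?d / ?N * (\<Sum>g\<in>carrier ?G. irr_char V (inv\<^bsub>?G\<^esub> g) * complex_of_real (fixed_weight n \<nu> g)))
        = ?d / ?N * (\<Sum>g\<in>carrier ?G. cnj (irr_char V g) * complex_of_real (fixed_weight n \<nu> g))"
      by simp
    also have "(\<Sum>g\<in>carrier ?G. cnj (irr_char V g) * complex_of_real (fixed_weight n \<nu> g))
        = (\<Sum>g\<in>carrier ?G. cnj (irr_char V g) * \<phi> g ^ r - (if g = id then cnj (irr_char V g) else 0))"
    proof (rule sum.cong[OF refl])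
      fix g assume "g \<in> carrier ?G"
      then have "g permutes {1..n}" by (simp only: sym_group_carrier)
      from fixed_\<nu>[OF this] show "cnj (irr_char V g) * complex_of_real (fixed_weight n \<nu> g)
          = cnj (irr_char V g) * \<phi> g ^ r - (if g = id then cnj (irr_char V g) else 0)"
        by (simp add: right_diff_distrib)
    qed
    also have "\<dots> = (\<Sum>g\<in>carrier ?G. cnj (irr_char V g) * \<phi> g ^ r) - cnj (irr_char V id)"
    proof -
      have "id \<in> carrier ?G" using G.one_closed unfolding one .
      moreover have "finite (carrier ?G)" unfolding carr by (rule finite_perms)
      ultimately show ?thesis unfolding sum_subtractf by (simp only: sum.delta if_True)
    qed
    also have "irr_char V id = ?d" using G.irr_char_one[OF V] unfolding one .
    also have "?d / ?N * ((\<Sum>g\<in>carrier ?G. cnj (irr_char V g) * \<phi> g ^ r) - cnj ?d)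
        = ?d * char_inner ?G (irr_char V) (\<lambda>g. \<phi> g ^ r) - complex_of_real (plancherel ?G V)"
      by (simp add: char_inner_def plancherel_def Coset.order_def right_diff_distrib power2_eq_square)
    finally have "cnj ?X = ?Y" .
    then show ?thesis using complex_mod_cnj[of ?X] by (simp only:)
  qed
  have "(\<Sum>V\<in>Irr ?G. cmod (of_nat (irr_dim V) * char_inner ?G (irr_char V) (\<lambda>g. \<phi> g ^ r)
        - complex_of_real (plancherel ?G V)))
      = (\<Sum>V\<in>Irr ?G. cmod (of_nat (irr_dim V) / of_nat (card (carrier ?G)) *
          (\<Sum>g\<in>carrier ?G. irr_char V (inv\<^bsub>?G\<^esub> g) * complex_of_real (fixed_weight n \<nu> g))))"
    by (rule sum.cong[OF refl summand_eq])
  also have "\<dots> \<le> (\<Sum>w\<in>perms n. \<bar>chamber_weight n \<nu> w\<bar>)"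
    by (rule multiplicities_le_chamber_weight[OF inv_\<nu>])
  also have "\<dots> = (\<Sum>w\<in>carrier ?G. \<bar>(Q [^]\<^bsub>group_algebra ?G\<^esub> r) w - 1 / fact n\<bar>)"
    unfolding carr by (intro sum.cong refl) (simp only: chamber_\<nu> mem_Collect_eq)
  finally show ?thesis
    unfolding total_variation_def \<phi>_def Q_def a_def by linarith
qed

end
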